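(* Let $G$ be a connected claw-free cubic multigraph with $G \not\cong K_4$. Let $k$ be the number of diamonds in $G$ and let $p$ be the number of digons in $G$. Then $G$ contains a $2$-bisection $(\bar{B},\bar{W})$ such that \[ \varepsilon(\bar{B},\bar{W}) = \begin{cases} \dfrac{|V(G)|-k-2p}{3} & \text{if } k \text{ is even},\\[2mm] \dfrac{|V(G)|-k-2p}{3}+1 & \text{if } k \text{ is odd}. \end{cases} \] Moreover, $\varepsilon(\bar{B},\bar{W}) \le \varepsilon(B,W)$ for every $2$-bisection $(B,W)$ of $G$.
   Context: A multigraph may have multiple (parallel) edges but no loops; it is cubic if every vertex has degree $3$. $G$ is claw-free if it contains no induced subgraph isomorphic to $K_{1,3}$. A bisection $(B,W)$ of $G$ is a partition of $V(G)$ into two sets $B,W$ with $|B|=|W|$; it is a $k$-bisection if every connected component of the induced subgraphs $G[B]$ and $G[W]$ has at most $k$ vertices. An edge is monochromatic (with respect to $(B,W)$) if both its endpoints lie in the same part, and $\varepsilon(B,W)$ denotes the number of monochromatic edges (parallel edges counted separately). A digon is an induced subgraph on two vertices consisting of a pair of parallel edges (a cycle of length two). A diamond is an induced subgraph isomorphic to $K_4 - e$, the complete graph on four vertices with one edge deleted.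
   Formalization: Here p counts only digons not contained in a triangle, and the graph with two vertices and three parallel edges counts as one digon; with every digon counted literally, the formula fails exactly for these graphs (e.g. two doubled-edge triangles joined by an edge give 2/3). *)

theory Defs
  imports Complex_Main
begin

text \<open>
  Undirected multigraphs with named edges: \<open>ends G e\<close> is the set of end-vertices of the
  edge \<open>e\<close>, so parallel edges are distinct edges with the same set of ends.
\<close>

record ('v, 'e) multigraph =
  verts :: "'v set"
  edges :: "'e set"
  ends :: "'e \<Rightarrow> 'v set"

text \<open>Finite multigraphs; the condition \<open>card (ends G e) = 2\<close> excludes loops.\<close>

definition multigraph :: "('v, 'e) multigraph \<Rightarrow> bool" where
  "multigraph G \<longleftrightarrow> finite (verts G) \<and> finite (edges G) \<and>
     (\<forall>e\<in>edges G. ends G e \<subseteq> verts G \<and> card (ends G e) = 2)"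

definition degree :: "('v, 'e) multigraph \<Rightarrow> 'v \<Rightarrow> nat" where
  "degree G v = card {e \<in> edges G. v \<in> ends G e}"

definition cubic :: "('v, 'e) multigraph \<Rightarrow> bool" where
  "cubic G \<longleftrightarrow> (\<forall>v\<in>verts G. degree G v = 3)"

definition adjacent :: "('v, 'e) multigraph \<Rightarrow> 'v \<Rightarrow> 'v \<Rightarrow> bool" where
  "adjacent G u v \<longleftrightarrow> (\<exists>e\<in>edges G. ends G e = {u, v})"

definition component_of :: "('v, 'e) multigraph \<Rightarrow> 'v \<Rightarrow> 'v set" where
  "component_of G u = {v \<in> verts G. (adjacent G)\<^sup>*\<^sup>* u v}"

definition components :: "('v, 'e) multigraph \<Rightarrow> 'v set set" where
  "components G = component_of G ` verts G"

definition connected_multigraph :: "('v, 'e) multigraph \<Rightarrow> bool" where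
  "connected_multigraph G \<longleftrightarrow>
     verts G \<noteq> {} \<and> (\<forall>u\<in>verts G. \<forall>v\<in>verts G. (adjacent G)\<^sup>*\<^sup>* u v)"

definition induced :: "('v, 'e) multigraph \<Rightarrow> 'v set \<Rightarrow> ('v, 'e) multigraph" where
  "induced G X = \<lparr>verts = verts G \<inter> X, edges = {e \<in> edges G. ends G e \<subseteq> X}, ends = ends G\<rparr>"

definition isomorphic :: "('v, 'e) multigraph \<Rightarrow> ('w, 'f) multigraph \<Rightarrow> bool" where
  "isomorphic G H \<longleftrightarrow>
     (\<exists>f g. bij_betw f (verts G) (verts H) \<and> bij_betw g (edges G) (edges H) \<and>
        (\<forall>e\<in>edges G. ends H (g e) = f ` ends G e))"

definition simple_graph :: "'v set \<Rightarrow> 'v set set \<Rightarrow> ('v, 'v set) multigraph" where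
  "simple_graph V E = \<lparr>verts = V, edges = E, ends = (\<lambda>e. e)\<rparr>"

definition K13 :: "(nat, nat set) multigraph" where
  "K13 = simple_graph {0, 1, 2, 3} {{0, 1}, {0, 2}, {0, 3}}"

definition K4 :: "(nat, nat set) multigraph" where
  "K4 = simple_graph {0, 1, 2, 3} {{0, 1}, {0, 2}, {0, 3}, {1, 2}, {1, 3}, {2, 3}}"

definition K4_minus_edge :: "(nat, nat set) multigraph" where
  "K4_minus_edge = simple_graph {0, 1, 2, 3} {{0, 1}, {0, 2}, {0, 3}, {1, 2}, {1, 3}}"

definition claw_free :: "('v, 'e) multigraph \<Rightarrow> bool" where
  "claw_free G \<longleftrightarrow> \<not> (\<exists>X\<subseteq>verts G. isomorphic (induced G X) K13)"

text \<open>Induced subgraphs are identified with their vertex sets.\<close>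

definition diamonds :: "('v, 'e) multigraph \<Rightarrow> 'v set set" where
  "diamonds G = {X. X \<subseteq> verts G \<and> isomorphic (induced G X) K4_minus_edge}"

text \<open>
  A digon is a pair of vertices joined by parallel edges. In a connected cubic multigraph such a
  pair induces exactly two edges, except in the graph with two vertices and three parallel edges,
  whose vertex set is counted here as one digon.
\<close>

definition digons :: "('v, 'e) multigraph \<Rightarrow> 'v set set" where
  "digons G = {X. X \<subseteq> verts G \<and> card X = 2 \<and> 2 \<le> card (edges (induced G X))}"

text \<open>
  Triangles need not be induced: two of the three vertices may be joined by parallel edges, and then
  the triangle contains a digon. Counting such digons would break the formula \<open>(n - k - 2 p) / 3\<close>,
  which arises from partitioning the vertices into \<open>k\<close> diamonds, \<open>p\<close> digons and triangles.
\<close>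

definition triangles :: "('v, 'e) multigraph \<Rightarrow> 'v set set" where
  "triangles G = {X. X \<subseteq> verts G \<and> card X = 3 \<and>
     (\<forall>u\<in>X. \<forall>v\<in>X. u \<noteq> v \<longrightarrow> adjacent G u v)}"

definition bisection :: "('v, 'e) multigraph \<Rightarrow> 'v set \<Rightarrow> 'v set \<Rightarrow> bool" where
  "bisection G B W \<longleftrightarrow> B \<union> W = verts G \<and> B \<inter> W = {} \<and> card B = card W"

definition k_bisection :: "nat \<Rightarrow> ('v, 'e) multigraph \<Rightarrow> 'v set \<Rightarrow> 'v set \<Rightarrow> bool" where
  "k_bisection k G B W \<longleftrightarrow> bisection G B W \<and>
     (\<forall>C \<in> components (induced G B) \<union> components (induced G W). card C \<le> k)"

definition monochromatic_edges :: "('v, 'e) multigraph \<Rightarrow> 'v set \<Rightarrow> 'v set \<Rightarrow> 'e set" where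
  "monochromatic_edges G B W = {e \<in> edges G. ends G e \<subseteq> B \<or> ends G e \<subseteq> W}"

definition num_mono :: "('v, 'e) multigraph \<Rightarrow> 'v set \<Rightarrow> 'v set \<Rightarrow> nat" where
  "num_mono G B W = card (monochromatic_edges G B W)"

end

theory Submission
  imports Defs "HOL-Library.Disjoint_Sets"
begin

text \<open>
  The vertices split into \<open>k\<close> diamonds, \<open>p\<close> digons and \<open>t\<close> triangles, so \<open>|V| = 4k + 3t + 2p\<close> and
  the claimed value is \<open>k + t\<close> or \<open>k + t + 1\<close>. In any bisection each diamond and each triangle
  contains a monochromatic edge; moreover \<open>B\<close> and \<open>W\<close> span equally many edges by counting degrees,
  so the number of monochromatic edges is even, while \<open>t\<close> is even because \<open>|V|\<close> is. This gives the
  lower bound.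

  For the upper bound call all vertices except the two inner vertices of each diamond ports. The
  edges leaving the pieces pair up the ports. A transition pairs the two ports of every digon and
  diamond and two ports of every triangle, and pairs the left-over triangle ports arbitrarily. The
  two pairings together form disjoint closed walks; choosing another pair in a triangle that meets
  two walks merges them, so some transition yields a single closed walk (an Euler tour of the
  contracted graph). Colour along it, switching at each paired edge and each transition except
  those of the diamonds. Any violated constraints can be shifted along the walk and cancelled until
  at most one remains, placed at a diamond, where it costs one additional monochromatic edge.
\<close>

section \<open>Transition systems on paired ports\<close>

text \<open>Around a single closed walk the prescribed number of colour changes is the number of
  ports minus one for each diamond. Since the number of ports is even, such a walk admits a
  colouring without violations exactly when \<open>k\<close> is even. The proof never follows a walk
  or computes this parity: a closed walk occurs only as a connected component of two involutions.
  Connectedness alone lets a violation be moved from any pair to any other, so all but one cancel.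
  The resulting bound \<open>k + t + 1\<close> becomes the exact value in both cases because the
  number of monochromatic edges is even.

  Two obstacles shape the rest. Without diamonds a leftover violation has nowhere to go, since the
  pairs in digons and triangles must be bichromatic for the two halves to be equal; a counting
  argument excludes it. With diamonds the transition may preserve colours, so it does not show that
  the halves are equal; a second pairing, which joins each inner vertex of a diamond to one of its
  ends, replaces it there.\<close>

definition pairing_on :: "'a set \<Rightarrow> ('a \<Rightarrow> 'a) \<Rightarrow> bool" where
  "pairing_on A h \<longleftrightarrow> (\<forall>x\<in>A. h x \<in> A \<and> h x \<noteq> x \<and> h (h x) = x)"

lemma even_card_pairing_on:
  assumes "finite A" "pairing_on A h"
  shows "even (card A)"
  using assms
proof (induction A rule: finite_psubset_induct)
  case (psubset A)
  show ?case
  proof (cases "A = {}")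
    case False
    then obtain x where x: "x \<in> A" by blast
    let ?A = "A - {x, h x}"
    have h: "h x \<in> A" "h x \<noteq> x" using psubset.prems x by (auto simp: pairing_on_def)
    have "pairing_on ?A h"
      using psubset.prems x unfolding pairing_on_def by (metis Diff_iff insert_iff singletonD)
    moreover have "?A \<subset> A" using x by blast
    ultimately have "even (card ?A)" using psubset.IH by blast
    moreover have "card A = card ?A + 2"
    proof -
      have "card (A - {x, h x}) = card A - card {x, h x}"
        using x h by (intro card_Diff_subset) auto
      moreover have "card {x, h x} \<le> card A"
        using x h psubset.hyps by (intro card_mono) auto
      ultimately show ?thesis using h by simp
    qed
    ultimately show ?thesis by simp
  qed simp
qed

lemma pairing_on_exists:
  assumes "finite A" "even (card A)"
  shows "\<exists>h. pairing_on A h"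
  using assms
proof (induction A rule: finite_psubset_induct)
  case (psubset A)
  show ?case
  proof (cases "A = {}")
    case False
    then obtain x where x: "x \<in> A" by blast
    have "A \<noteq> {x}" using psubset.prems by auto
    then obtain y where y: "y \<in> A" "y \<noteq> x" using x by blast
    let ?A = "A - {x, y}"
    have "card (A - {x, y}) = card A - card {x, y}"
      using x y by (intro card_Diff_subset) auto
    then have "even (card ?A)" using y psubset.prems by auto
    moreover have "?A \<subset> A" using x by blast
    ultimately obtain h where "pairing_on ?A h" using psubset.IH by blast
    then have "pairing_on A (h(x := y, y := x))"
      using x y unfolding pairing_on_def by auto
    then show ?thesis by blast
  qed (simp add: pairing_on_def)
qed

lemma card_balanced_pairing_on:
  assumes "pairing_on A h" "\<And>x. x \<in> A \<Longrightarrow> f (h x) = (\<not> f x)"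
  shows "card {x \<in> A. f x} = card {x \<in> A. \<not> f x}"
  by (rule bij_betw_same_card[of h], rule bij_betw_byWitness[where f' = h])
    (use assms in \<open>auto simp: pairing_on_def\<close>)

text \<open>Every point lies in at most one member of \<open>\<D>\<close>, so local solutions can be
  read off member by member. The last assumption says that \<open>R X h\<close> depends only on the
  values of \<open>h\<close> on \<open>X\<close>; \<open>pairing_on\<close> has this property
  because it leaves values outside its set unconstrained.\<close>

lemma glue_disjoint:
  assumes "disjoint \<D>"
    and "\<And>X. X \<in> \<D> \<Longrightarrow> \<exists>h. R X h"
    and cong: "\<And>X h h'. X \<in> \<D> \<Longrightarrow> (\<And>v. v \<in> X \<Longrightarrow> h' v = h v) \<Longrightarrow> R X h \<Longrightarrow> R X h'"
  shows "\<exists>h. \<forall>X\<in>\<D>. R X h"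
proof -
  obtain H where H: "\<And>X. X \<in> \<D> \<Longrightarrow> R X (H X)" using assms(2) by metis
  define h where "h v = H (THE X. X \<in> \<D> \<and> v \<in> X) v" for v
  have "R X h" if X: "X \<in> \<D>" for X
  proof (rule cong[OF X _ H[OF X]])
    fix v assume "v \<in> X"
    then have "(THE Y. Y \<in> \<D> \<and> v \<in> Y) = X"
      using X assms(1) by (intro the_equality) (auto simp: disjoint_def)
    then show "h v = H X v" by (simp add: h_def)
  qed
  then show ?thesis by blast
qed

text \<open>Only the ports of the graph are kept. \<open>m\<close> stands for the pairing along
  edges, and \<open>connected\<close> says that contracting every piece to one vertex gives a
  connected multigraph.\<close>

locale port_system =
  fixes Q :: "'a set" and m :: "'a \<Rightarrow> 'a" and \<P> :: "'a set set"
  assumes finite_Q: "finite Q"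
    and m: "pairing_on Q m"
    and part: "partition_on Q \<P>"
    and card_piece: "\<And>X. X \<in> \<P> \<Longrightarrow> card X = 2 \<or> card X = 3"
    and connected: "\<And>C. C \<subseteq> Q \<Longrightarrow> C \<noteq> {} \<Longrightarrow> m ` C \<subseteq> C
      \<Longrightarrow> (\<And>X. X \<in> \<P> \<Longrightarrow> X \<subseteq> C \<or> X \<inter> C = {}) \<Longrightarrow> C = Q"
begin

text \<open>One internal pair per piece suffices: it exhausts a piece with two ports and leaves over
  one port of a piece with three, which may be paired with any other left-over port.\<close>

definition transition :: "('a \<Rightarrow> 'a) \<Rightarrow> bool" where
  "transition n \<longleftrightarrow> pairing_on Q n \<and> (\<forall>X\<in>\<P>. \<exists>x\<in>X. n x \<in> X)"

definition step :: "('a \<Rightarrow> 'a) \<Rightarrow> 'a \<Rightarrow> 'a \<Rightarrow> bool" where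
  "step n u v \<longleftrightarrow> u \<in> Q \<and> (v = m u \<or> v = n u)"

lemma mD: "u \<in> Q \<Longrightarrow> m u \<in> Q" "u \<in> Q \<Longrightarrow> m u \<noteq> u" "u \<in> Q \<Longrightarrow> m (m u) = u"
  using m by (auto simp: pairing_on_def)

lemma nD:
  assumes "transition n" "u \<in> Q"
  shows "n u \<in> Q" "n u \<noteq> u" "n (n u) = u"
  using assms by (auto simp: transition_def pairing_on_def)

lemma piece_subset: "X \<in> \<P> \<Longrightarrow> X \<subseteq> Q"
  using part by (auto simp: partition_on_def)

lemma symp_step: "transition n \<Longrightarrow> symp (step n)"
  unfolding symp_def step_def using mD nD by metis

lemma step_in_Q: "(step n)\<^sup>*\<^sup>* u v \<Longrightarrow> transition n \<Longrightarrow> u \<in> Q \<Longrightarrow> v \<in> Q"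
  by (induction rule: rtranclp_induct) (auto simp: step_def mD nD)

text \<open>The chosen pairs cover an even number of ports and \<open>m\<close> makes
  \<open>card Q\<close> even, so the left-over ports can be paired among themselves.\<close>

lemma transition_exists: "\<exists>n. transition n"
proof -
  have fin: "finite X" if "X \<in> \<P>" for X
    using piece_subset[OF that] finite_Q finite_subset by blast
  have "\<exists>Y\<subseteq>X. card Y = 2" if "X \<in> \<P>" for X
    using obtain_subset_with_card_n[of 2 X] card_piece[OF that] by (metis eval_nat_numeral(3) le_Suc_eq le_refl)
  then obtain Y where Y: "\<And>X. X \<in> \<P> \<Longrightarrow> Y X \<subseteq> X" "\<And>X. X \<in> \<P> \<Longrightarrow> card (Y X) = 2"
    by metis
  have disj: "disjoint \<P>" using part by (auto simp: partition_on_def)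
  define U where "U = \<Union>(Y ` \<P>)"
  have "U \<subseteq> Q" using Y(1) piece_subset unfolding U_def by blast
  have "finite \<P>" using part finite_Q finite_elements by blast
  have "card U = (\<Sum>X\<in>\<P>. card (Y X))" unfolding U_def
  proof (rule card_UN_disjoint)
    show "\<forall>i\<in>\<P>. finite (Y i)" using fin Y(1) finite_subset by blast
    show "\<forall>i\<in>\<P>. \<forall>j\<in>\<P>. i \<noteq> j \<longrightarrow> Y i \<inter> Y j = {}"
      using Y(1) disj unfolding disjoint_def by blast
  qed fact
  also have "even \<dots>" using Y(2) by (intro dvd_sum) simp
  finally have "even (card (Q - U))"
    using even_card_pairing_on[OF finite_Q m] \<open>U \<subseteq> Q\<close> finite_Q
    by (simp add: card_Diff_subset finite_subset card_mono)
  define \<D> where "\<D> = insert (Q - U) (Y ` \<P>)"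
  have "disjoint \<D>"
    unfolding \<D>_def
  proof (rule disjointI)
    fix a b assume ab: "a \<in> insert (Q - U) (Y ` \<P>)" "b \<in> insert (Q - U) (Y ` \<P>)" "a \<noteq> b"
    have *: "a \<inter> b = {}" if ab': "a \<in> Y ` \<P>" "b \<in> Y ` \<P>"
    proof -
      obtain X X' where "X \<in> \<P>" "X' \<in> \<P>" "a = Y X" "b = Y X'" "X \<noteq> X'"
        using ab(3) ab' by blast
      then show ?thesis using Y(1) disjointD[OF disj] by blast
    qed
    have "c \<subseteq> U" if "c \<in> Y ` \<P>" for c using that unfolding U_def by blast
    then show "a \<inter> b = {}" using ab * by blast
  qed
  moreover have "\<exists>h. pairing_on Z h" if "Z \<in> \<D>" for Z
  proof (rule pairing_on_exists)
    have "Z \<subseteq> Q" using that \<open>U \<subseteq> Q\<close> Sup_upper[of Z "Y ` \<P>"] unfolding \<D>_def U_def by auto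
    then show "finite Z" using finite_Q finite_subset by blast
    show "even (card Z)" using that \<open>even (card (Q - U))\<close> Y(2) unfolding \<D>_def by auto
  qed
  ultimately have "\<exists>n. \<forall>Z\<in>\<D>. pairing_on Z n"
    by (rule glue_disjoint) (auto simp: pairing_on_def)
  then obtain n where n: "\<And>Z. Z \<in> \<D> \<Longrightarrow> pairing_on Z n" by blast
  have "\<exists>Z\<in>\<D>. Z \<subseteq> Q \<and> v \<in> Z" if "v \<in> Q" for v
    using that \<open>U \<subseteq> Q\<close> unfolding \<D>_def U_def by (cases "v \<in> U") (auto simp: U_def)
  then have "pairing_on Q n" using n unfolding pairing_on_def by (meson subsetD)
  moreover have "\<exists>x\<in>X. n x \<in> X" if "X \<in> \<P>" for X
  proof -
    have "pairing_on (Y X) n" using n that unfolding \<D>_def by blast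
    moreover have "Y X \<noteq> {}" using Y(2)[OF that] by force
    ultimately show ?thesis using Y(1)[OF that] unfolding pairing_on_def by blast
  qed
  ultimately show ?thesis unfolding transition_def by blast
qed

section \<open>Merging closed walks by an exchange of pairs\<close>

definition off_step :: "('a \<Rightarrow> 'a) \<Rightarrow> 'a set \<Rightarrow> 'a \<Rightarrow> 'a \<Rightarrow> bool" where
  "off_step n Z u v \<longleftrightarrow> u \<in> Q \<and> (v = m u \<or> u \<notin> Z \<and> v = n u)"

text \<open>Deleting the pair \<open>{x, n x}\<close> does not disconnect its component: otherwise one of the two
  parts would have even cardinality by \<open>m\<close> and odd cardinality by \<open>n\<close>.\<close>

lemma off_step_pair:
  assumes n: "transition n" and x: "x \<in> Q" and z: "z \<in> Q" and xz: "\<not> (step n)\<^sup>*\<^sup>* x z"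
  defines "Z \<equiv> {x, n x, z, n z}"
  shows "(off_step n Z)\<^sup>*\<^sup>* x (n x)"
proof (rule ccontr)
  assume nx: "\<not> (off_step n Z)\<^sup>*\<^sup>* x (n x)"
  define K where "K = {w. (off_step n Z)\<^sup>*\<^sup>* x w}"
  have le: "(step n)\<^sup>*\<^sup>* x w" if "w \<in> K" for w
    using that unfolding K_def mem_Collect_eq
    by (rule rtranclp_mono[THEN predicate2D, rotated]) (auto simp: off_step_def step_def)
  have KQ: "K \<subseteq> Q" using le step_in_Q n x by blast
  \<comment> \<open>The pair \<open>{z, n z}\<close> belongs to another component, so deleting it as
    well changes nothing that is reachable from \<open>x\<close>.\<close>
  have "z \<notin> K" using le xz by blast
  have "n z \<notin> K"
  proof
    assume "n z \<in> K"
    then have "(step n)\<^sup>*\<^sup>* x (n z)" using le by blast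
    moreover have "step n (n z) z" using nD[OF n z] by (auto simp: step_def)
    ultimately show False using xz by (meson rtranclp.rtrancl_into_rtrancl)
  qed
  have K: "w \<in> K \<Longrightarrow> off_step n Z w w' \<Longrightarrow> w' \<in> K" for w w'
    unfolding K_def by auto
  have "pairing_on K m"
    using K KQ mD unfolding pairing_on_def off_step_def by blast
  then have "even (card K)" using even_card_pairing_on KQ finite_Q finite_subset by blast
  \<comment> \<open>Among the ports of \<open>Z\<close> only \<open>x\<close> lies in
    \<open>K\<close>, so \<open>n\<close> is intact on all other ports of \<open>K\<close>.\<close>
  have "pairing_on (K - {x}) n"
    unfolding pairing_on_def
  proof
    fix w assume w: "w \<in> K - {x}"
    then have "w \<notin> Z" "w \<in> Q" using \<open>z \<notin> K\<close> \<open>n z \<notin> K\<close> nx KQ unfolding Z_def K_def by auto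
    then have "n w \<in> K" using K w by (auto simp: off_step_def)
    moreover have "n w \<noteq> x" using \<open>w \<notin> Z\<close> nD[OF n \<open>w \<in> Q\<close>] unfolding Z_def by auto
    ultimately show "n w \<in> K - {x} \<and> n w \<noteq> w \<and> n (n w) = w" using nD[OF n \<open>w \<in> Q\<close>] by auto
  qed
  then have "even (card (K - {x}))" using even_card_pairing_on KQ finite_Q finite_subset
    by (metis finite_Diff)
  moreover have "x \<in> K" by (simp add: K_def)
  moreover have "finite K" using KQ finite_Q finite_subset by blast
  ultimately show False using \<open>even (card K)\<close>
    by (metis card_Suc_Diff1 even_Suc)
qed

text \<open>Extremal choice: take a transition with the most ordered pairs of ports joined by a
  walk. If it were disconnected, some piece would meet two components, and re-pairing there would
  join new ports without separating old ones.\<close>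

lemma transition_connected_exists:
  "\<exists>n. transition n \<and> (\<forall>u\<in>Q. \<forall>v\<in>Q. (step n)\<^sup>*\<^sup>* u v)"
proof -
  define E where "E n = {(u, v). u \<in> Q \<and> v \<in> Q \<and> (step n)\<^sup>*\<^sup>* u v}" for n
  have EQ: "E n \<subseteq> Q \<times> Q" for n unfolding E_def by auto
  have finE: "finite (E n)" for n using EQ finite_Q by (meson finite_SigmaI finite_subset)
  have "\<exists>n. transition n \<and> (\<forall>n'. transition n' \<longrightarrow> card (E n') \<le> card (E n))"
  proof -
    obtain n0 where "transition n0" using transition_exists by blast
    moreover have "\<forall>n. transition n \<longrightarrow> card (E n) \<le> card (Q \<times> Q)"
      using EQ finite_Q by (meson card_mono finite_SigmaI)
    \<comment> \<open>The principle of the greatest value asks for a strict bound, hence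
      \<open>Suc\<close>.\<close>
    ultimately show ?thesis using ex_has_greatest_nat[of transition n0 "\<lambda>n. card (E n)" "Suc (card (Q \<times> Q))"]
      by (auto simp: less_Suc_eq_le)
  qed
  then obtain n where n: "transition n"
    and max: "\<And>n'. transition n' \<Longrightarrow> card (E n') \<le> card (E n)" by blast
  have sym: "(step n)\<^sup>*\<^sup>* u v \<Longrightarrow> (step n)\<^sup>*\<^sup>* v u" for u v
    using symp_rtranclp[OF symp_step[OF n]] by (rule sympD)
  have "(step n)\<^sup>*\<^sup>* u v" if u: "u \<in> Q" and v: "v \<in> Q" for u v
  proof (rule ccontr)
    assume uv: "\<not> (step n)\<^sup>*\<^sup>* u v"
    define C where "C = {w. (step n)\<^sup>*\<^sup>* u w}"
    have CQ: "C \<subseteq> Q" using step_in_Q n u unfolding C_def by blast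
    have Cstep: "w \<in> C \<Longrightarrow> step n w w' \<Longrightarrow> w' \<in> C" for w w' unfolding C_def by auto
    have "m ` C \<subseteq> C" using Cstep CQ by (auto simp: step_def)
    moreover have "C \<noteq> Q" "C \<noteq> {}" using uv v by (auto simp: C_def)
    ultimately obtain X where X: "X \<in> \<P>" "\<not> X \<subseteq> C" "X \<inter> C \<noteq> {}"
      using connected[OF CQ] by blast
    obtain x where x: "x \<in> X" "n x \<in> X" using n X(1) unfolding transition_def by blast
    have XQ: "X \<subseteq> Q" using piece_subset X(1) by blast
    have xQ: "x \<in> Q" using x XQ by blast
    have Cn: "x \<in> C \<longleftrightarrow> n x \<in> C"
      using Cstep[of x "n x"] Cstep[of "n x" x] xQ nD[OF n xQ] by (auto simp: step_def)
    \<comment> \<open>The pair \<open>x\<close>, \<open>n x\<close> lies on one side of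
      \<open>C\<close> while \<open>X\<close> meets both sides, so \<open>X\<close> has a third port
      on the other side.\<close>
    obtain z where z: "z \<in> X" "z \<in> C \<longleftrightarrow> x \<notin> C" using X by blast
    have zQ: "z \<in> Q" using z XQ by blast
    have ne: "z \<noteq> x" "z \<noteq> n x" using z Cn by auto
    have Xeq: "X = {x, n x, z}"
    proof -
      have "card {x, n x, z} = 3" using ne nD[OF n xQ] by auto
      moreover have "{x, n x, z} \<subseteq> X" using x z by auto
      moreover have "finite X" using XQ finite_Q finite_subset by blast
      ultimately show ?thesis using card_piece[OF X(1)]
        by (metis card_mono card_subset_eq le_antisym numeral_le_iff order_refl semiring_norm(72) eval_nat_numeral(3) Suc_n_not_le_n)
    qed
    have xz: "\<not> (step n)\<^sup>*\<^sup>* x z"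
    proof
      assume "(step n)\<^sup>*\<^sup>* x z"
      then have "x \<in> C \<longleftrightarrow> z \<in> C" using sym unfolding C_def mem_Collect_eq
        by (meson rtranclp_trans)
      then show False using z by blast
    qed
    have zx: "\<not> (step n)\<^sup>*\<^sup>* z x" using sym xz by blast
    have nz: "n z \<notin> {x, n x, z}"
    proof -
      have "n z \<noteq> x" using nD(3)[OF n zQ] ne by auto
      moreover have "n z \<noteq> n x" using nD(3)[OF n zQ] nD(3)[OF n xQ] ne by metis
      ultimately show ?thesis using nD[OF n zQ] by auto
    qed
    define Z where "Z = {x, n x, z, n z}"
    \<comment> \<open>The pairs \<open>{x, n x}\<close> and \<open>{z, n z}\<close> become
      \<open>{x, z}\<close> and \<open>{n x, n z}\<close>. The first new pair lies in
      \<open>X\<close>, so \<open>X\<close> keeps an internal pair.\<close>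
    define n' where "n' = n(x := z, z := x, n x := n z, n z := n x)"
    have n'_off: "n' w = n w" if "w \<notin> Z" for w using that by (auto simp: n'_def Z_def)
    have n'_on: "n' x = z" "n' z = x" "n' (n x) = n z" "n' (n z) = n x"
      using ne nz nD[OF n xQ] by (auto simp: n'_def)
    have Zn: "w \<in> Q \<Longrightarrow> n w \<in> Z \<longleftrightarrow> w \<in> Z" for w
      unfolding Z_def using nD(3)[OF n] xQ zQ by (metis insert_iff singletonD)
    have n': "transition n'"
      unfolding transition_def
    proof (intro conjI ballI)
      show "pairing_on Q n'" unfolding pairing_on_def
      proof
        fix w assume w: "w \<in> Q"
        show "n' w \<in> Q \<and> n' w \<noteq> w \<and> n' (n' w) = w"
        proof (cases "w \<in> Z")
          case True
          then show ?thesis using n'_on nD[OF n xQ] nD[OF n zQ] xQ zQ ne nz unfolding Z_def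
            by (elim insertE) auto
        next
          case False
          then show ?thesis using n'_off Zn[OF w] nD[OF n w] by auto
        qed
      qed
    next
      fix Y assume Y: "Y \<in> \<P>"
      show "\<exists>w\<in>Y. n' w \<in> Y"
      proof (cases "Y = X")
        case True
        then show ?thesis using x z n'_on by auto
      next
        case False
        then have "Y \<inter> X = {}" using Y X(1) part by (auto simp: partition_on_def disjoint_def)
        obtain w where w: "w \<in> Y" "n w \<in> Y" using n Y unfolding transition_def by blast
        \<comment> \<open>The only port of \<open>Z\<close> that can lie outside \<open>X\<close> is
          \<open>n z\<close>, and its old partner \<open>z\<close> is in \<open>X\<close>; hence no
          other piece loses its internal pair.\<close>
        have "w \<notin> Z"
          using w \<open>Y \<inter> X = {}\<close> Xeq nD(3)[OF n zQ] unfolding Z_def by auto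
        then have "n' w \<in> Y" using w n'_off by auto
        then show ?thesis using w by blast
      qed
    qed
    have sym': "(step n')\<^sup>*\<^sup>* u v \<Longrightarrow> (step n')\<^sup>*\<^sup>* v u" for u v
      using symp_rtranclp[OF symp_step[OF n']] by (rule sympD)
    have off: "(step n')\<^sup>*\<^sup>* u v" if "(off_step n Z)\<^sup>*\<^sup>* u v" for u v
      using that by (rule rtranclp_mono[THEN predicate2D, rotated]) (auto simp: off_step_def step_def n'_off)
    \<comment> \<open>The ends of each deleted pair stay joined by the rest of their own walk, so no
      old connection is lost.\<close>
    have xnx: "(step n')\<^sup>*\<^sup>* x (n x)"
      using off_step_pair[OF n xQ zQ xz] unfolding Z_def[symmetric] by (rule off)
    have znz: "(step n')\<^sup>*\<^sup>* z (n z)"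
      using off_step_pair[OF n zQ xQ zx] by (intro off) (simp add: Z_def insert_commute)
    have one: "(step n')\<^sup>*\<^sup>* u v" if "step n u v" for u v
    proof (cases "u \<in> Z \<and> v = n u")
      case True
      then show ?thesis using xnx znz sym' nD(3)[OF n xQ] nD(3)[OF n zQ] unfolding Z_def by auto
    next
      case False
      then have "step n' u v" using that n'_off by (auto simp: step_def)
      then show ?thesis by blast
    qed
    have "(step n')\<^sup>*\<^sup>* u v" if "(step n)\<^sup>*\<^sup>* u v" for u v
      using that by (induction rule: rtranclp_induct) (auto intro: one rtranclp_trans)
    then have "E n \<subseteq> E n'" unfolding E_def by auto
    moreover have "(x, z) \<in> E n'" using xQ zQ n'_on unfolding E_def by (auto simp: step_def)
    moreover have "(x, z) \<notin> E n" using xz unfolding E_def by auto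
    ultimately have "card (E n) < card (E n')" using finE by (intro psubset_card_mono) auto
    then show False using max[OF n'] by simp
  qed
  then show ?thesis using n by blast
qed

section \<open>Colourings along a connected transition\<close>

definition proper :: "('a \<Rightarrow> bool) \<Rightarrow> bool" where
  "proper f \<longleftrightarrow> (\<forall>v\<in>Q. f (m v) = (\<not> f v))"

text \<open>\<open>S\<close> holds the ports whose transition shall keep the colour. When
  \<open>S\<close> is a union of pairs of \<open>n\<close>, a bad pair is recorded at both of its
  ports.\<close>

definition violated :: "('a \<Rightarrow> 'a) \<Rightarrow> 'a set \<Rightarrow> ('a \<Rightarrow> bool) \<Rightarrow> 'a set" where
  "violated n S f = {v \<in> Q. (f (n v) = f v) \<noteq> (v \<in> S)}"

lemma proper_exists: "\<exists>f. proper f"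
proof -
  \<comment> \<open>The choice depends only on the set \<open>{v, m v}\<close>, so exactly one port
    of each pair is selected.\<close>
  define f where "f v \<longleftrightarrow> v = (SOME w. w \<in> {v, m v})" for v
  have "f (m v) = (\<not> f v)" if v: "v \<in> Q" for v
  proof -
    define w where "w = (SOME w. w \<in> {v, m v})"
    have "w \<in> {v, m v}" unfolding w_def by (rule someI_ex) auto
    moreover have "{m v, m (m v)} = {v, m v}" using mD(3)[OF v] by auto
    then have "f (m v) \<longleftrightarrow> m v = w" by (simp add: f_def w_def)
    moreover have "f v \<longleftrightarrow> v = w" by (simp add: f_def w_def)
    ultimately show ?thesis using mD(2)[OF v] by auto
  qed
  then show ?thesis unfolding proper_def by blast
qed

text \<open>Swapping the colours of the pair \<open>{y, m y}\<close> keeps the colouring proper and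
  toggles the status of the transitions at \<open>y\<close> and at \<open>m y\<close>, so a
  violation at one travels to the other. The disequalities are symmetric differences: two violations
  that meet at the same pair cancel.\<close>

lemma move_violation:
  assumes n: "transition n" and "(step n)\<^sup>*\<^sup>* u w" and u: "u \<in> Q" and f: "proper f"
  shows "\<exists>f'. proper f' \<and> (\<forall>v\<in>Q. v \<in> violated n S f' \<longleftrightarrow>
    ((v \<in> violated n S f) \<noteq> ((v \<in> {u, n u}) \<noteq> (v \<in> {w, n w}))))"
  using assms(2)
proof (induction rule: rtranclp_induct)
  case base
  then show ?case using f by auto
next
  case (step y w)
  then obtain g where g: "proper g" and gv: "\<And>v. v \<in> Q \<Longrightarrow> v \<in> violated n S g \<longleftrightarrow>
    ((v \<in> violated n S f) \<noteq> ((v \<in> {u, n u}) \<noteq> (v \<in> {y, n y})))" by blast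
  have y: "y \<in> Q" using step.hyps by (simp add: step_def)
  show ?case
  proof (cases "w = n y")
    \<comment> \<open>Here \<open>w\<close> and \<open>y\<close> name the same transition, so
      nothing has to be recoloured.\<close>
    case True
    then have "{w, n w} = {y, n y}" using nD(3)[OF n y] by auto
    then show ?thesis using g gv by metis
  next
    case False
    then have w: "w = m y" using step.hyps by (simp add: step_def)
    note yD = mD[OF y]
    define h where "h x \<longleftrightarrow> g x \<noteq> (x \<in> {y, w})" for x
    have "proper h" unfolding proper_def
    proof
      fix v assume v: "v \<in> Q"
      have "m v = y \<longleftrightarrow> v = w" "m v = w \<longleftrightarrow> v = y" using w yD mD[OF v] by metis+
      then have "m v \<in> {y, w} \<longleftrightarrow> v \<in> {y, w}" by blast
      then show "h (m v) = (\<not> h v)" using g v unfolding h_def proper_def by auto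
    qed
    moreover have "v \<in> violated n S h \<longleftrightarrow>
      ((v \<in> violated n S f) \<noteq> ((v \<in> {u, n u}) \<noteq> (v \<in> {w, n w})))" if v: "v \<in> Q" for v
    proof -
      have "n v = y \<longleftrightarrow> v = n y" "n v = w \<longleftrightarrow> v = n w"
        using nD(3)[OF n v] nD(3)[OF n y] nD(3)[OF n, of w] w yD(1) by metis+
      moreover have "w \<noteq> y" "n y \<noteq> y" "n w \<noteq> w" using w yD(1,2) nD(2)[OF n] y by auto
      ultimately have "(v \<in> violated n S h) = ((v \<in> violated n S g) \<noteq> ((v \<in> {y, n y}) \<noteq> (v \<in> {w, n w})))"
        using v unfolding violated_def h_def by auto
      then show ?thesis unfolding gv[OF v] by argo
    qed
    ultimately show ?thesis by blast
  qed
qed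

text \<open>Take a proper colouring with the fewest violated ports outside the pair of
  \<open>u0\<close>. A violation outside could be moved onto that pair, which would lower the
  number.\<close>

lemma colouring_one_violation:
  assumes n: "transition n" and S: "\<And>v. v \<in> Q \<Longrightarrow> n v \<in> S \<longleftrightarrow> v \<in> S"
    and conn: "\<forall>u\<in>Q. \<forall>v\<in>Q. (step n)\<^sup>*\<^sup>* u v" and u0: "u0 \<in> Q"
  shows "\<exists>f. proper f \<and> violated n S f \<subseteq> {u0, n u0}"
proof -
  \<comment> \<open>The pair of \<open>u0\<close> is not counted, since an arriving violation may
    either create or cancel one there.\<close>
  define \<mu> where "\<mu> f = card (violated n S f - {u0, n u0})" for f
  obtain f0 where "proper f0" using proper_exists by blast
  then obtain f where f: "proper f" and min: "\<And>g. proper g \<Longrightarrow> \<mu> f \<le> \<mu> g"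
    using ex_has_least_nat[of proper f0 \<mu>] by auto
  have "violated n S f \<subseteq> {u0, n u0}"
  proof (rule ccontr)
    assume "\<not> ?thesis"
    then obtain u where u: "u \<in> violated n S f" "u \<notin> {u0, n u0}" by blast
    then have uQ: "u \<in> Q" by (simp add: violated_def)
    have "(step n)\<^sup>*\<^sup>* u u0" using conn uQ u0 by blast
    then obtain g where g: "proper g" and gv: "\<And>v. v \<in> Q \<Longrightarrow> v \<in> violated n S g \<longleftrightarrow>
      ((v \<in> violated n S f) \<noteq> ((v \<in> {u, n u}) \<noteq> (v \<in> {u0, n u0})))"
      using move_violation[OF n _ uQ f, of u0 S] by blast
    have vQ: "violated n S h \<subseteq> Q" for h by (auto simp: violated_def)
    have nu: "n u \<in> violated n S f"
      using u(1) S[OF uQ] nD[OF n uQ] unfolding violated_def by auto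
    have "violated n S g - {u0, n u0} \<subset> violated n S f - {u0, n u0}"
    proof (rule psubsetI)
      show "violated n S g - {u0, n u0} \<subseteq> violated n S f - {u0, n u0}"
      proof
        fix v assume v: "v \<in> violated n S g - {u0, n u0}"
        then have "v \<in> Q" using vQ by blast
        then show "v \<in> violated n S f - {u0, n u0}" using gv[of v] v u(1) nu by auto
      qed
      have "u \<notin> violated n S g" using gv[OF uQ] u by simp
      then show "violated n S g - {u0, n u0} \<noteq> violated n S f - {u0, n u0}" using u by auto
    qed
    moreover have "finite (violated n S f)" using vQ finite_Q finite_subset by blast
    ultimately have "\<mu> g < \<mu> f" unfolding \<mu>_def by (intro psubset_card_mono) auto
    then show False using min[OF g] by simp
  qed
  then show ?thesis using f by blast
qed

text \<open>The one violation that may remain, at \<open>{u, n u}\<close>, is refuted by counting: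
  \<open>m\<close> gives equally many ports of each colour, and \<open>n\<close> does so on all
  other ports, so \<open>u\<close> and \<open>n u\<close> must differ too.\<close>

lemma colouring_no_violation:
  assumes n: "transition n" and conn: "\<forall>u\<in>Q. \<forall>v\<in>Q. (step n)\<^sup>*\<^sup>* u v"
  shows "\<exists>f. proper f \<and> violated n {} f = {}"
proof (cases "Q = {}")
  case True
  then have "proper f \<and> violated n {} f = {}" for f unfolding proper_def violated_def by blast
  then show ?thesis by blast
next
  case False
  then obtain u where u: "u \<in> Q" by blast
  then obtain f where f: "proper f" and v: "violated n {} f \<subseteq> {u, n u}"
    using colouring_one_violation[OF n _ conn, where S = "{}"] by blast
  note uD = nD[OF n u]
  have "f (n u) \<noteq> f u"
  proof
    assume eq: "f (n u) = f u"
    let ?R = "Q - {u, n u}"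
    have "pairing_on ?R n"
      using nD[OF n] uD u unfolding pairing_on_def by (metis Diff_iff insert_iff singletonD)
    moreover have "f (n w) = (\<not> f w)" if "w \<in> ?R" for w using that v unfolding violated_def by auto
    ultimately have R: "card {w \<in> ?R. f w} = card {w \<in> ?R. \<not> f w}"
      by (rule card_balanced_pairing_on)
    have Q: "card {w \<in> Q. f w} = card {w \<in> Q. \<not> f w}"
      by (rule card_balanced_pairing_on[OF m]) (use f in \<open>auto simp: proper_def\<close>)
    have split: "card {w \<in> Q. P w} = card {w \<in> ?R. P w} + card {w \<in> {u, n u}. P w}" for P
      by (subst card_Un_disjoint[symmetric]) (use finite_Q u uD in \<open>auto intro: arg_cong[where f = card]\<close>)
    have "card {w \<in> {u, n u}. f w} = card {w \<in> {u, n u}. \<not> f w}"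
      using R Q split[of f] split[of "\<lambda>w. \<not> f w"] by simp
    moreover have "{w \<in> {u, n u}. f w} = (if f u then {u, n u} else {})"
      "{w \<in> {u, n u}. \<not> f w} = (if f u then {} else {u, n u})" using eq by auto
    ultimately show False using uD by (auto split: if_splits)
  qed
  then have "u \<notin> violated n {} f" "n u \<notin> violated n {} f"
    using uD(3) unfolding violated_def by simp_all
  then have "violated n {} f = {}" using v by blast
  then show ?thesis using f by blast
qed

text \<open>\<open>F\<close> stands for the port pairs of the diamonds, where the transition shall
  keep the colour. A leftover violation is put into \<open>X0\<close>; if \<open>F\<close> is empty
  there is no place for it, and the statement without violations is used.\<close>

theorem port_colouring:
  assumes F: "F \<subseteq> \<P>" "\<And>X. X \<in> F \<Longrightarrow> card X = 2"
  shows "\<exists>f n X0. transition n \<and> proper f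
    \<and> (\<forall>v\<in>Q - \<Union>F. f (n v) = (\<not> f v))
    \<and> (\<forall>X\<in>F - {X0}. \<forall>u\<in>X. \<forall>v\<in>X. f u = f v)"
proof -
  obtain n where n: "transition n" and conn: "\<forall>u\<in>Q. \<forall>v\<in>Q. (step n)\<^sup>*\<^sup>* u v"
    using transition_connected_exists by blast
  \<comment> \<open>A piece with two ports is nothing but its internal pair.\<close>
  have FX: "\<exists>x\<in>Q. X = {x, n x}" if X: "X \<in> F" for X
  proof -
    obtain x where x: "x \<in> X" "n x \<in> X" using n X F(1) unfolding transition_def by blast
    have xQ: "x \<in> Q" using x X F(1) piece_subset by blast
    have "finite X" using F(2)[OF X] by (metis card.infinite zero_neq_numeral)
    then have "X = {x, n x}" using x F(2)[OF X] nD[OF n xQ]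
      by (metis card_2_iff card_subset_eq empty_subsetI insert_subset)
    then show ?thesis using xQ by blast
  qed
  show ?thesis
  proof (cases "F = {}")
    case True
    obtain f where "proper f" "violated n {} f = {}" using colouring_no_violation[OF n conn] by blast
    then show ?thesis using n True by (intro exI[of _ f] exI[of _ n]) (auto simp: violated_def)
  next
    case False
    then obtain X0 where X0: "X0 \<in> F" by blast
    then obtain u0 where u0: "u0 \<in> Q" "X0 = {u0, n u0}" using FX by blast
    have S: "n w \<in> \<Union>F \<longleftrightarrow> w \<in> \<Union>F" if w: "w \<in> Q" for w
    proof -
      have "n w \<in> \<Union>F" if w': "w \<in> \<Union>F" "w \<in> Q" for w
      proof -
        obtain X where X: "X \<in> F" "w \<in> X" using w' by blast
        then obtain x where "x \<in> Q" "X = {x, n x}" using FX by blast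
        then have "n w \<in> X" using X nD(3)[OF n] by auto
        then show ?thesis using X by blast
      qed
      then show ?thesis using nD[OF n w] w by metis
    qed
    obtain f where f: "proper f" and v: "violated n (\<Union>F) f \<subseteq> X0"
      using colouring_one_violation[OF n S conn u0(1)] u0(2) by blast
    have disj: "X \<inter> X0 = {}" if "X \<in> F - {X0}" for X
      using that X0 F(1) part by (auto simp: partition_on_def disjoint_def)
    have "f u = f w" if X: "X \<in> F - {X0}" and "u \<in> X" "w \<in> X" for X u w
    proof -
      obtain x where x: "x \<in> Q" "X = {x, n x}" using FX X by blast
      then have "x \<notin> violated n (\<Union>F) f" using disj[OF X] v by blast
      then have "f (n x) = f x" using x X unfolding violated_def by auto
      then show ?thesis using that x by auto
    qed
    moreover have "f (n w) = (\<not> f w)" if "w \<in> Q - \<Union>F" for w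
    proof -
      have "w \<notin> violated n (\<Union>F) f" using that v X0 by blast
      then show ?thesis using that unfolding violated_def by auto
    qed
    ultimately show ?thesis using n f by (intro exI[of _ f] exI[of _ n] exI[of _ X0]) blast
  qed
qed

end

section \<open>Pieces of a claw-free cubic multigraph\<close>

lemma even_num_mono:
  assumes G: "multigraph G" "cubic G" and B: "bisection G B W"
  shows "even (num_mono G B W)"
proof -
  have fin: "finite (edges G)" "finite (verts G)" using G(1) by (auto simp: multigraph_def)
  have BW: "B \<union> W = verts G" "B \<inter> W = {}" "card B = card W" using B by (auto simp: bisection_def)
  have finBW: "finite B" "finite W" using BW fin by (metis finite_Un)+
  have sum: "(\<Sum>e\<in>edges G. card (ends G e \<inter> S)) = 3 * card S" if S: "S \<subseteq> verts G" for S
  proof -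
    have finS: "finite S" using S fin finite_subset by blast
    have "(\<Sum>e\<in>edges G. card (ends G e \<inter> S)) = (\<Sum>e\<in>edges G. \<Sum>v\<in>S. of_bool (v \<in> ends G e))"
      using finS by (intro sum.cong refl) (simp add: sum.If_cases of_bool_def Int_commute)
    also have "\<dots> = (\<Sum>v\<in>S. \<Sum>e\<in>edges G. of_bool (v \<in> ends G e))" by (rule sum.swap)
    also have "\<dots> = (\<Sum>v\<in>S. degree G v)"
      using fin by (intro sum.cong refl) (simp add: degree_def of_bool_def sum.If_cases Int_def)
    also have "\<dots> = 3 * card S" using S G(2) by (simp add: cubic_def subset_iff)
    finally show ?thesis .
  qed
  let ?M = "\<lambda>S. {e \<in> edges G. ends G e \<subseteq> S}"
  \<comment> \<open>An edge inside \<open>B\<close> contributes 2, one inside \<open>W\<close>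
    contributes -2, and any other edge 0. Over all edges the left sides add up to three times
    \<open>card B\<close> minus three times \<open>card W\<close>, which is 0.\<close>
  have "int (card (ends G e \<inter> B)) - int (card (ends G e \<inter> W))
      = 2 * of_bool (ends G e \<subseteq> B) - 2 * of_bool (ends G e \<subseteq> W)" if e: "e \<in> edges G" for e
  proof -
    have en: "card (ends G e) = 2" "ends G e \<subseteq> verts G" using e G(1) by (auto simp: multigraph_def)
    then obtain u v where uv: "ends G e = {u, v}" "u \<noteq> v" by (auto simp: card_2_iff)
    then have "u \<in> B \<longleftrightarrow> u \<notin> W" "v \<in> B \<longleftrightarrow> v \<notin> W" using en BW by auto
    then show ?thesis using uv by (cases "u \<in> B"; cases "v \<in> B") (auto simp: Int_insert_left)
  qed
  then have "(\<Sum>e\<in>edges G. int (card (ends G e \<inter> B)) - int (card (ends G e \<inter> W)))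
     = (\<Sum>e\<in>edges G. 2 * of_bool (ends G e \<subseteq> B) - 2 * of_bool (ends G e \<subseteq> W))"
    by (rule sum.cong[OF refl])
  moreover have "(\<Sum>e\<in>edges G. int (card (ends G e \<inter> B)) - int (card (ends G e \<inter> W))) = 0"
  proof -
    have "B \<subseteq> verts G" "W \<subseteq> verts G" using BW by auto
    then show ?thesis using sum[of B] sum[of W] BW(3)
      by (simp add: sum_subtractf flip: of_nat_sum)
  qed
  moreover have "(\<Sum>e\<in>edges G. of_bool (ends G e \<subseteq> S)) = int (card (?M S))" for S
    using fin by (simp add: of_bool_def sum.If_cases Int_def)
  ultimately have "card (?M B) = card (?M W)"
    by (simp add: sum_subtractf flip: sum_distrib_left)
  moreover have "num_mono G B W = card (?M B) + card (?M W)"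
    unfolding num_mono_def
  proof (subst card_Un_disjoint[symmetric])
    show "?M B \<inter> ?M W = {}"
    proof (rule equals0I)
      fix e assume "e \<in> ?M B \<inter> ?M W"
      then have "ends G e = {}" "e \<in> edges G" using BW by auto
      then show False using G(1) by (auto simp: multigraph_def)
    qed
    show "card (monochromatic_edges G B W) = card (?M B \<union> ?M W)"
      by (rule arg_cong[where f = card]) (auto simp: monochromatic_edges_def)
  qed (use fin in auto)
  ultimately show ?thesis by simp
qed

section \<open>Edge multiplicities and induced subgraphs on four vertices\<close>

definition mult :: "('v, 'e) multigraph \<Rightarrow> 'v \<Rightarrow> 'v \<Rightarrow> nat" where
  "mult G u v = card {e \<in> edges G. ends G e = {u, v}}"

lemma mult_commute: "mult G u v = mult G v u"
  by (simp add: mult_def insert_commute)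

lemma mult_pos_edge: "0 < mult G u v \<Longrightarrow> \<exists>e\<in>edges G. ends G e = {u, v}"
  unfolding mult_def by (metis (mono_tags, lifting) card_gt_0_iff empty_Collect_eq)

lemma mult_pos_iff:
  assumes "multigraph G"
  shows "0 < mult G u v \<longleftrightarrow> adjacent G u v"
  using assms by (auto simp: mult_def adjacent_def multigraph_def card_gt_0_iff)

text \<open>Removes edge names from isomorphisms with a simple graph: once all multiplicities are 0
  or 1, the vertex bijection determines the edge bijection.\<close>

lemma isomorphic_simple_graph_iff:
  assumes G: "multigraph G" and X: "X \<subseteq> verts G" and F: "\<And>e. e \<in> F \<Longrightarrow> e \<subseteq> W \<and> card e = 2"
  shows "isomorphic (induced G X) (simple_graph W F) \<longleftrightarrow>
    (\<exists>f. bij_betw f X W \<and> (\<forall>u\<in>X. \<forall>v\<in>X. u \<noteq> v \<longrightarrow> mult G u v = of_bool ({f u, f v} \<in> F)))"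
    (is "?L \<longleftrightarrow> ?R")
proof
  let ?E = "{e \<in> edges G. ends G e \<subseteq> X}"
  have VX: "verts G \<inter> X = X" using X by auto
  {
    assume ?L
    then obtain f g where f: "bij_betw f X W" and g: "bij_betw g ?E F"
      and gf: "\<And>e. e \<in> ?E \<Longrightarrow> g e = f ` ends G e"
      unfolding isomorphic_def induced_def simple_graph_def by (auto simp: VX)
    have "mult G u v = of_bool ({f u, f v} \<in> F)" if uv: "u \<in> X" "v \<in> X" "u \<noteq> v" for u v
    proof -
      let ?S = "{e \<in> edges G. ends G e = {u, v}}"
      have S: "?S \<subseteq> ?E" using uv by auto
      have gS: "g e = {f u, f v}" if "e \<in> ?S" for e using gf[of e] that S by auto
      show ?thesis
      proof (cases "{f u, f v} \<in> F")
        case True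
        then have "{f u, f v} \<in> g ` ?E" using g by (simp add: bij_betw_def)
        then obtain e where e: "e \<in> ?E" "g e = {f u, f v}" by force
        then have "f ` ends G e = f ` {u, v}" using gf by auto
        moreover have "ends G e \<subseteq> X" "{u, v} \<subseteq> X" using e uv by auto
        ultimately have "ends G e = {u, v}"
          using f inj_on_image_eq_iff[of f X "ends G e" "{u, v}"] by (auto simp: bij_betw_def)
        then have "e \<in> ?S" using e by auto
        moreover have "e' = e" if "e' \<in> ?S" for e'
          using gS[OF that] e that S g unfolding bij_betw_def by (metis (lifting) inj_onD subsetD)
        ultimately have "?S = {e}" by blast
        then show ?thesis using True by (simp add: mult_def)
      next
        case False
        then have "?S = {}" using gS g S unfolding bij_betw_def by (metis (lifting) equals0I imageI subsetD)
        then show ?thesis using False unfolding mult_def by (simp only: card.empty of_bool_eq)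
      qed
    qed
    then show ?R using f by blast
  }
  {
    assume ?R
    then obtain f where f: "bij_betw f X W"
      and m: "\<And>u v. u \<in> X \<Longrightarrow> v \<in> X \<Longrightarrow> u \<noteq> v \<Longrightarrow> mult G u v = of_bool ({f u, f v} \<in> F)" by blast
    have inj: "inj_on f X" using f by (simp add: bij_betw_def)
    have Ee: "\<exists>u v. ends G e = {u, v} \<and> u \<noteq> v \<and> u \<in> X \<and> v \<in> X" if "e \<in> ?E" for e
    proof -
      have "card (ends G e) = 2" using that G by (simp add: multigraph_def)
      then obtain u v where "ends G e = {u, v}" "u \<noteq> v" unfolding card_2_iff by blast
      then show ?thesis using that by blast
    qed
    \<comment> \<open>The edge map is forced by \<open>f\<close>; it is injective because no
      multiplicity exceeds 1.\<close>
    have "bij_betw (\<lambda>e. f ` ends G e) ?E F"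
      unfolding bij_betw_def
    proof (intro conjI equalityI subsetI inj_onI)
      fix e e' assume e: "e \<in> ?E" "e' \<in> ?E" "f ` ends G e = f ` ends G e'"
      then have eq: "ends G e = ends G e'" using inj_on_image_eq_iff[OF inj] by auto
      obtain u v where uv: "ends G e = {u, v}" "u \<noteq> v" "u \<in> X" "v \<in> X" using Ee[OF e(1)] by blast
      let ?S = "{e \<in> edges G. ends G e = {u, v}}"
      have "card ?S \<le> Suc 0" using m[of u v] uv by (simp add: mult_def)
      moreover have "finite ?S" using G by (simp add: multigraph_def)
      ultimately have "\<forall>a\<in>?S. \<forall>b\<in>?S. a = b" by (simp only: card_le_Suc0_iff_eq)
      moreover have "e \<in> ?S" "e' \<in> ?S" using e uv eq by auto
      ultimately show "e = e'" by blast
    next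
      fix s assume "s \<in> (\<lambda>e. f ` ends G e) ` ?E"
      then obtain e where e: "e \<in> ?E" "s = f ` ends G e" by blast
      obtain u v where uv: "ends G e = {u, v}" "u \<noteq> v" "u \<in> X" "v \<in> X" using Ee[OF e(1)] by blast
      have "0 < mult G u v" using e uv mult_pos_iff[OF G] by (auto simp: adjacent_def)
      then show "s \<in> F" using m uv e by auto
    next
      fix s assume s: "s \<in> F"
      obtain a b where ab: "s = {a, b}" "a \<noteq> b" "a \<in> W" "b \<in> W" using F[OF s] by (auto simp: card_2_iff)
      obtain u v where uv: "u \<in> X" "v \<in> X" "f u = a" "f v = b"
      proof -
        have "a \<in> f ` X" "b \<in> f ` X" using ab f by (auto simp: bij_betw_def)
        then show ?thesis using that by blast
      qed
      moreover have "u \<noteq> v" using uv ab(2) by auto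
      ultimately have "0 < mult G u v" using m[of u v] ab s by simp
      then obtain e where "e \<in> edges G" "ends G e = {u, v}" using mult_pos_edge[of G u v] by blast
      then have "e \<in> ?E" "f ` ends G e = s" using uv ab by auto
      then show "s \<in> (\<lambda>e. f ` ends G e) ` ?E" by (intro image_eqI[of _ _ e]) simp_all
    qed
    then show ?L using f unfolding isomorphic_def induced_def simple_graph_def by (auto simp: VX)
  }
qed

lemma induced_verts:
  assumes "multigraph G"
  shows "induced G (verts G) = G"
proof -
  have "{e \<in> edges G. ends G e \<subseteq> verts G} = edges G" using assms by (auto simp: multigraph_def)
  then show ?thesis by (simp add: induced_def)
qed

locale claw_free_cubic =
  fixes G :: "('v, 'e) multigraph"
  assumes G: "multigraph G"
    and conn: "connected_multigraph G"
    and claw_free: "claw_free G"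
    and cubic: "cubic G"
    and not_K4: "\<not> isomorphic G K4"
begin

abbreviation \<mu> :: "'v \<Rightarrow> 'v \<Rightarrow> nat" where
  "\<mu> \<equiv> mult G"

lemma finite_verts: "finite (verts G)" and finite_edges: "finite (edges G)"
  using G by (auto simp: multigraph_def)

lemma mult_self [simp]: "\<mu> v v = 0"
proof -
  have "{e \<in> edges G. ends G e = {v, v}} = {}" using G by (auto simp: multigraph_def)
  then show ?thesis unfolding mult_def by (simp only: card.empty)
qed

lemma mult_pos_verts: "0 < \<mu> u v \<Longrightarrow> u \<in> verts G" "0 < \<mu> u v \<Longrightarrow> v \<in> verts G"
  using mult_pos_edge[of G u v] G by (auto simp: multigraph_def)

lemma mult_pos_neq: "0 < \<mu> u v \<Longrightarrow> u \<noteq> v"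
  by (metis less_irrefl mult_self)

lemma sum_mult:
  assumes v: "v \<in> verts G"
  shows "(\<Sum>u\<in>verts G. \<mu> v u) = 3"
proof -
  have "card (\<Union>u\<in>verts G. {e \<in> edges G. ends G e = {v, u}}) = (\<Sum>u\<in>verts G. \<mu> v u)"
    unfolding mult_def by (rule card_UN_disjoint) (auto simp: finite_verts finite_edges doubleton_eq_iff)
  moreover have "(\<Union>u\<in>verts G. {e \<in> edges G. ends G e = {v, u}}) = {e \<in> edges G. v \<in> ends G e}"
    using G unfolding multigraph_def by (fastforce simp: card_2_iff)
  ultimately show ?thesis using cubic v by (simp add: cubic_def degree_def)
qed

text \<open>The form in which cubicity is used from here on: a contradiction arises as soon as
  distinct vertices with total multiplicity above 3 are found around \<open>v\<close>.\<close>

lemma sum_mult_le: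
  assumes "finite S"
  shows "(\<Sum>u\<in>S. \<mu> v u) \<le> 3"
proof (cases "v \<in> verts G")
  case True
  have "(\<Sum>u\<in>S. \<mu> v u) = (\<Sum>u\<in>S \<inter> verts G. \<mu> v u)"
    using mult_pos_verts(2)[of v] assms by (intro sum.mono_neutral_right) auto
  also have "\<dots> \<le> (\<Sum>u\<in>verts G. \<mu> v u)"
    by (rule sum_mono2) (auto simp: finite_verts)
  finally show ?thesis using sum_mult[OF True] by simp
next
  case False
  then have "\<mu> v u = 0" for u using mult_pos_verts(1)[of v u] by blast
  then show ?thesis by simp
qed

lemma mult_le3_2: "x \<noteq> y \<Longrightarrow> \<mu> v x + \<mu> v y \<le> 3"
  using sum_mult_le[of "{x, y}" v] by simp

lemma mult_le3_3: "distinct [x, y, z] \<Longrightarrow> \<mu> v x + \<mu> v y + \<mu> v z \<le> 3"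
  using sum_mult_le[of "{x, y, z}" v] by simp

lemma mult_le3_4: "distinct [x, y, z, w] \<Longrightarrow> \<mu> v x + \<mu> v y + \<mu> v z + \<mu> v w \<le> 3"
  using sum_mult_le[of "{x, y, z, w}" v] by simp

text \<open>\<open>a\<close> and \<open>b\<close> are the inner vertices, \<open>c\<close> and
  \<open>d\<close> the two non-adjacent ends.\<close>

definition diamond :: "'v \<Rightarrow> 'v \<Rightarrow> 'v \<Rightarrow> 'v \<Rightarrow> bool" where
  "diamond a b c d \<longleftrightarrow> distinct [a, b, c, d] \<and> \<mu> a b = 1 \<and> \<mu> a c = 1 \<and> \<mu> a d = 1
     \<and> \<mu> b c = 1 \<and> \<mu> b d = 1 \<and> \<mu> c d = 0"

text \<open>\<open>K13\<close>, \<open>K4\<close> and \<open>K4_minus_edge\<close> share the vertex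
  set {0, 1, 2, 3}, so one normal form serves all three.\<close>

lemma isomorphic_four_iff:
  fixes F :: "nat set set"
  assumes X: "X \<subseteq> verts G" and F: "\<And>e. e \<in> F \<Longrightarrow> e \<subseteq> {0, 1, 2, 3} \<and> card e = 2"
  shows "isomorphic (induced G X) (simple_graph {0, 1, 2, 3} F) \<longleftrightarrow>
    (\<exists>a b c d. X = {a, b, c, d} \<and> distinct [a, b, c, d]
      \<and> \<mu> a b = of_bool ({0, 1} \<in> F) \<and> \<mu> a c = of_bool ({0, 2} \<in> F) \<and> \<mu> a d = of_bool ({0, 3} \<in> F)
      \<and> \<mu> b c = of_bool ({1, 2} \<in> F) \<and> \<mu> b d = of_bool ({1, 3} \<in> F) \<and> \<mu> c d = of_bool ({2, 3} \<in> F))"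
    (is "?L \<longleftrightarrow> (\<exists>a b c d. ?R a b c d)")
proof -
  define good where "good f \<longleftrightarrow> bij_betw f X {0, 1, 2, 3} \<and>
    (\<forall>u\<in>X. \<forall>v\<in>X. u \<noteq> v \<longrightarrow> \<mu> u v = of_bool ({f u, f v} \<in> F))" for f
  have iff: "?L \<longleftrightarrow> (\<exists>f. good f)"
    unfolding good_def by (rule isomorphic_simple_graph_iff[OF G X F])
  show ?thesis
  proof
    assume ?L
    then obtain f where f: "bij_betw f X {0, 1, 2, 3}" and m: "\<And>u v. u \<in> X \<Longrightarrow> v \<in> X \<Longrightarrow> u \<noteq> v \<Longrightarrow>
        \<mu> u v = of_bool ({f u, f v} \<in> F)"
      unfolding iff good_def by blast
    have im: "f ` X = {0, 1, 2, 3}" and inj: "inj_on f X" using f by (auto simp: bij_betw_def)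
    have "0 \<in> f ` X" "1 \<in> f ` X" "2 \<in> f ` X" "3 \<in> f ` X" unfolding im by auto
    then obtain a b c d where "a \<in> X \<and> 0 = f a" "b \<in> X \<and> 1 = f b" "c \<in> X \<and> 2 = f c" "d \<in> X \<and> 3 = f d"
      by (elim imageE) blast
    then have abcd: "a \<in> X" "b \<in> X" "c \<in> X" "d \<in> X"
      and fa: "f a = 0" "f b = 1" "f c = 2" "f d = 3"
      by simp_all
    have "x \<in> {a, b, c, d}" if x: "x \<in> X" for x
    proof -
      have "f x \<in> {0, 1, 2, 3}" using im x by blast
      then have "f x = f a \<or> f x = f b \<or> f x = f c \<or> f x = f d" using fa by auto
      then show ?thesis using inj_onD[OF inj _ x] abcd by blast
    qed
    then have Xe: "X = {a, b, c, d}" using abcd by blast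
    have d: "distinct [a, b, c, d]" using fa by auto
    then have "?R a b c d"
      using m[of a b] m[of a c] m[of a d] m[of b c] m[of b d] m[of c d] abcd fa Xe by simp
    then show "\<exists>a b c d. ?R a b c d" by blast
  next
    assume "\<exists>a b c d. ?R a b c d"
    then obtain a b c d where Xe: "X = {a, b, c, d}" and d: "distinct [a, b, c, d]"
      and m: "\<mu> a b = of_bool ({0, 1} \<in> F)" "\<mu> a c = of_bool ({0, 2} \<in> F)" "\<mu> a d = of_bool ({0, 3} \<in> F)"
        "\<mu> b c = of_bool ({1, 2} \<in> F)" "\<mu> b d = of_bool ({1, 3} \<in> F)" "\<mu> c d = of_bool ({2, 3} \<in> F)" by blast
    define f where "f x = (if x = a then 0 else if x = b then 1 else if x = c then 2 else 3::nat)" for x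
    have fa: "f a = 0" "f b = 1" "f c = 2" "f d = 3" using d by (auto simp: f_def)
    have "bij_betw f X {0, 1, 2, 3}" unfolding bij_betw_def inj_on_def Xe by (auto simp: fa)
    moreover have "\<mu> u v = of_bool ({f u, f v} \<in> F)" if uv: "u \<in> X" "v \<in> X" "u \<noteq> v" for u v
    proof -
      \<comment> \<open>Both sides are symmetric in \<open>u\<close> and \<open>v\<close>, so six of
        the twelve ordered pairs suffice.\<close>
      have sym: "\<mu> v u = of_bool ({f v, f u} \<in> F)" if "\<mu> u v = of_bool ({f u, f v} \<in> F)" for u v
        using that by (simp add: mult_commute[of G v u] insert_commute)
      have "\<mu> a b = of_bool ({f a, f b} \<in> F)" "\<mu> a c = of_bool ({f a, f c} \<in> F)"
        "\<mu> a d = of_bool ({f a, f d} \<in> F)" "\<mu> b c = of_bool ({f b, f c} \<in> F)"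
        "\<mu> b d = of_bool ({f b, f d} \<in> F)" "\<mu> c d = of_bool ({f c, f d} \<in> F)"
        using m unfolding fa by simp_all
      note * = this this[THEN sym]
      show ?thesis using uv unfolding Xe by (elim insertE emptyE; use * in \<open>simp only: simp_thms\<close>)
    qed
    ultimately show ?L unfolding iff good_def by blast
  qed
qed

lemma diamonds_iff: "X \<in> diamonds G \<longleftrightarrow> (\<exists>a b c d. X = {a, b, c, d} \<and> diamond a b c d)"
proof -
  have "isomorphic (induced G X) K4_minus_edge \<longleftrightarrow> (\<exists>a b c d. X = {a, b, c, d} \<and> diamond a b c d)"
    if X: "X \<subseteq> verts G"
    unfolding K4_minus_edge_def diamond_def
    by (subst isomorphic_four_iff[OF X]) (auto simp: doubleton_eq_iff)
  moreover have "X \<subseteq> verts G" if "X = {a, b, c, d}" "diamond a b c d" for a b c d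
    using that mult_pos_verts[of a b] mult_pos_verts[of a c] mult_pos_verts[of a d] by (auto simp: diamond_def)
  ultimately show ?thesis unfolding diamonds_def by blast
qed

text \<open>The degree bound at \<open>a\<close> and \<open>b\<close> makes the five edges simple.
  If \<open>c\<close> and \<open>d\<close> were adjacent as well, no edge could leave the four
  vertices and connectedness would turn the whole graph into \<open>K4\<close>; this is where that
  graph has to be excluded.\<close>

lemma diamondI:
  assumes d: "distinct [a, b, c, d]"
    and pos: "0 < \<mu> a b" "0 < \<mu> a c" "0 < \<mu> a d" "0 < \<mu> b c" "0 < \<mu> b d"
  shows "diamond a b c d"
proof -
  have a: "\<mu> a b + \<mu> a c + \<mu> a d \<le> 3" and b: "\<mu> b a + \<mu> b c + \<mu> b d \<le> 3"
    using d by (auto intro!: mult_le3_3)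
  have ones: "\<mu> a b = 1" "\<mu> a c = 1" "\<mu> a d = 1" "\<mu> b c = 1" "\<mu> b d = 1"
    using a b pos by (auto simp: mult_commute)
  have "\<mu> c d = 0"
  proof (rule ccontr)
    assume cd: "\<mu> c d \<noteq> 0"
    have "\<mu> c a + \<mu> c b + \<mu> c d \<le> 3" using d by (intro mult_le3_3) auto
    then have cd1: "\<mu> c d = 1" using cd ones by (simp add: mult_commute)
    let ?X = "{a, b, c, d}"
    have nb: "w \<in> ?X" if v: "v \<in> ?X" and "0 < \<mu> v w" for v w
    proof (rule ccontr)
      assume w: "w \<notin> ?X"
      have "\<mu> a b + \<mu> a c + \<mu> a d + \<mu> a w \<le> 3" "\<mu> b a + \<mu> b c + \<mu> b d + \<mu> b w \<le> 3"
        "\<mu> c a + \<mu> c b + \<mu> c d + \<mu> c w \<le> 3" "\<mu> d a + \<mu> d b + \<mu> d c + \<mu> d w \<le> 3"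
        using d w by (auto intro!: mult_le3_4)
      then show False using that ones cd1 by (auto simp: mult_commute)
    qed
    have "v \<in> ?X" if "(adjacent G)\<^sup>*\<^sup>* a v" for v
      using that by (induction rule: rtranclp_induct) (use nb mult_pos_iff[OF G] in blast)+
    moreover have XV: "?X \<subseteq> verts G"
      using pos mult_pos_verts[of a b] mult_pos_verts[of a c] mult_pos_verts[of a d] by auto
    ultimately have X: "verts G = ?X" using conn unfolding connected_multigraph_def by blast
    have "isomorphic (induced G ?X) K4"
      unfolding K4_def
    proof (subst isomorphic_four_iff[OF XV])
      show "e \<subseteq> {0, 1, 2, 3} \<and> card e = 2"
        if "e \<in> {{0, 1}, {0, 2}, {0, 3}, {1, 2}, {1, 3}, {2, 3}}" for e :: "nat set"
        using that by auto
    qed (rule exI[of _ a], rule exI[of _ b], rule exI[of _ c], rule exI[of _ d],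
        use d ones cd1 in \<open>simp add: doubleton_eq_iff\<close>)
    then show False using not_K4 X induced_verts[OF G] by simp
  qed
  then show ?thesis using ones d by (simp add: diamond_def)
qed

text \<open>Three distinct neighbours use up the degree, so the edges at \<open>v\<close> are
  simple, and pairwise non-adjacent neighbours would induce a claw.\<close>

lemma claw_freeD:
  assumes d: "distinct [v, x, y, z]" and pos: "0 < \<mu> v x" "0 < \<mu> v y" "0 < \<mu> v z"
  shows "0 < \<mu> x y \<or> 0 < \<mu> x z \<or> 0 < \<mu> y z"
proof (rule ccontr)
  assume "\<not> ?thesis"
  then have zero: "\<mu> x y = 0" "\<mu> x z = 0" "\<mu> y z = 0" by auto
  have "\<mu> v x + \<mu> v y + \<mu> v z \<le> 3" using d by (intro mult_le3_3) auto
  then have one: "\<mu> v x = 1" "\<mu> v y = 1" "\<mu> v z = 1" using pos by auto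
  have XV: "{v, x, y, z} \<subseteq> verts G"
    using pos mult_pos_verts[of v x] mult_pos_verts[of v y] mult_pos_verts[of v z] by auto
  have "isomorphic (induced G {v, x, y, z}) K13"
    unfolding K13_def
  proof (subst isomorphic_four_iff[OF XV])
    show "e \<subseteq> {0, 1, 2, 3} \<and> card e = 2" if "e \<in> {{0, 1}, {0, 2}, {0, 3}}" for e :: "nat set"
      using that by auto
  qed (rule exI[of _ v], rule exI[of _ x], rule exI[of _ y], rule exI[of _ z],
      use d one zero in \<open>simp add: doubleton_eq_iff\<close>)
  then show False using claw_free XV unfolding claw_free_def by blast
qed

lemma triangles_iff: "X \<in> triangles G \<longleftrightarrow>
   (\<exists>x y z. X = {x, y, z} \<and> distinct [x, y, z] \<and> 0 < \<mu> x y \<and> 0 < \<mu> x z \<and> 0 < \<mu> y z)"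
proof
  assume "X \<in> triangles G"
  then have X: "card X = 3" "\<And>u v. u \<in> X \<Longrightarrow> v \<in> X \<Longrightarrow> u \<noteq> v \<Longrightarrow> 0 < \<mu> u v"
    by (auto simp: triangles_def mult_pos_iff[OF G])
  then obtain x y z where "X = {x, y, z}" "distinct [x, y, z]" by (auto simp: card_3_iff)
  then show "\<exists>x y z. X = {x, y, z} \<and> distinct [x, y, z] \<and> 0 < \<mu> x y \<and> 0 < \<mu> x z \<and> 0 < \<mu> y z"
    using X(2) by (intro exI[of _ x] exI[of _ y] exI[of _ z]) auto
next
  assume "\<exists>x y z. X = {x, y, z} \<and> distinct [x, y, z] \<and> 0 < \<mu> x y \<and> 0 < \<mu> x z \<and> 0 < \<mu> y z"
  then obtain x y z where *: "X = {x, y, z}" "distinct [x, y, z]" "0 < \<mu> x y" "0 < \<mu> x z" "0 < \<mu> y z"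
    by blast
  then have "0 < \<mu> y x" "0 < \<mu> z x" "0 < \<mu> z y" by (auto simp: mult_commute)
  then show "X \<in> triangles G"
    using * mult_pos_verts by (auto simp: triangles_def mult_pos_iff[OF G, symmetric])
qed

lemma digons_iff: "X \<in> digons G \<longleftrightarrow> (\<exists>u v. X = {u, v} \<and> u \<noteq> v \<and> 2 \<le> \<mu> u v)"
proof -
  have "card (edges (induced G {u, v})) = \<mu> u v" if "u \<noteq> v" for u v
  proof -
    have "ends G e = {u, v}" if "e \<in> edges G" "ends G e \<subseteq> {u, v}" for e
      using that G \<open>u \<noteq> v\<close> unfolding multigraph_def
      by (metis card_2_iff card_subset_eq finite.emptyI finite.insertI)
    then have "{e \<in> edges G. ends G e \<subseteq> {u, v}} = {e \<in> edges G. ends G e = {u, v}}" by auto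
    then show ?thesis by (simp add: induced_def mult_def)
  qed
  then have *: "2 \<le> card (edges (induced G X)) \<longleftrightarrow> 2 \<le> \<mu> u v" if "X = {u, v}" "u \<noteq> v" for u v
    using that by simp
  have V: "{u, v} \<subseteq> verts G" if "2 \<le> \<mu> u v" for u v
  proof -
    have "0 < \<mu> u v" using that by simp
    then show ?thesis using mult_pos_verts by blast
  qed
  show ?thesis
  proof
    assume "X \<in> digons G"
    then have X: "card X = 2" "2 \<le> card (edges (induced G X))" by (auto simp: digons_def)
    obtain u v where "X = {u, v}" "u \<noteq> v" using X(1) unfolding card_2_iff by blast
    then show "\<exists>u v. X = {u, v} \<and> u \<noteq> v \<and> 2 \<le> \<mu> u v" using * X(2) by blast
  next
    assume "\<exists>u v. X = {u, v} \<and> u \<noteq> v \<and> 2 \<le> \<mu> u v"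
    then obtain u v where uv: "X = {u, v}" "u \<noteq> v" "2 \<le> \<mu> u v" by blast
    then show "X \<in> digons G" using *[OF uv(1,2)] V[OF uv(3)] by (simp add: digons_def)
  qed
qed

section \<open>Partition of the vertices into diamonds, triangles and digons\<close>

definition free_triangles :: "'v set set" where
  "free_triangles = {T \<in> triangles G. \<forall>X\<in>diamonds G. T \<inter> X = {}}"

definition free_digons :: "'v set set" where
  "free_digons = {D \<in> digons G. \<not> (\<exists>T\<in>triangles G. D \<subseteq> T)}"

text \<open>Diamonds take precedence over triangles, and triangles over digons; otherwise the pieces
  would overlap.\<close>

definition pieces :: "'v set set" where
  "pieces = diamonds G \<union> free_triangles \<union> free_digons"

lemma diamond_commute: "diamond a b c d \<Longrightarrow> diamond b a c d" "diamond a b c d \<Longrightarrow> diamond a b d c"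
  by (auto simp: diamond_def mult_commute)

lemma diamond_inner:
  assumes dia: "diamond a b c d" and u: "0 < \<mu> a u"
  shows "u \<in> {b, c, d}"
proof (rule ccontr)
  assume "u \<notin> {b, c, d}"
  then have "\<mu> a b + \<mu> a c + \<mu> a d + \<mu> a u \<le> 3"
    using dia by (intro mult_le3_4) (auto simp: diamond_def)
  then show False using dia u by (simp add: diamond_def)
qed

lemma diamond_simple:
  assumes dia: "diamond a b c d" and v: "v \<in> {a, b, c, d}"
  shows "\<mu> v u \<le> 1"
proof -
  have inner: "\<mu> a u \<le> 1" if dia: "diamond a b c d" for a b
  proof (cases "0 < \<mu> a u")
    case True
    then have "u \<in> {b, c, d}" using diamond_inner[OF dia] by blast
    then show ?thesis using dia by (auto simp: diamond_def)
  qed simp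
  have outer: "\<mu> c u \<le> 1" if dia: "diamond a b c d" for c d
  proof (cases "u \<in> {a, b}")
    case True
    then show ?thesis using dia by (auto simp: diamond_def mult_commute)
  next
    case False
    then have "\<mu> c a + \<mu> c b + \<mu> c u \<le> 3" using dia by (intro mult_le3_3) (auto simp: diamond_def)
    then show ?thesis using dia by (auto simp: diamond_def mult_commute)
  qed
  show ?thesis using v inner[OF dia] inner[OF diamond_commute(1)[OF dia]]
    outer[OF dia] outer[OF diamond_commute(2)[OF dia]] by blast
qed

text \<open>An inner vertex and its neighbours make up the whole diamond, so diamonds with a common
  inner vertex coincide. If an inner vertex of one is an end of the other, the two adjacent inner
  vertices of the latter are among its neighbours, and one of them must be inner in both. If only
  ends are shared, a common end would have four neighbours.\<close>

lemma diamonds_disjoint: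
  assumes X: "X \<in> diamonds G" and Y: "Y \<in> diamonds G" and "X \<inter> Y \<noteq> {}"
  shows "X = Y"
proof -
  have inner_eq: "{a, b, c, d} = {a', b', c', d'}"
    if dia: "diamond a b c d" "diamond a' b' c' d'" and a: "a \<in> {a', b'}" for a b c d a' b' c' d'
  proof -
    define N where "N = insert a {u. 0 < \<mu> a u}"
    have *: "N = {a, b, c, d}" if "diamond a b c d" for b c d
      using diamond_inner[OF that] that unfolding N_def diamond_def by auto
    have "N = {a', b', c', d'}"
    proof (cases "a = a'")
      case True
      then show ?thesis using * dia(2) by blast
    next
      case False
      then have "a = b'" using a by blast
      then have "N = {b', a', c', d'}" using * diamond_commute(1)[OF dia(2)] by blast
      then show ?thesis by blast
    qed
    then show ?thesis using *[OF dia(1)] by simp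
  qed
  have mid: "{a, b, c, d} = {a', b', c', d'}"
    if dia: "diamond a b c d" "diamond a' b' c' d'" and a: "a \<in> {a', b', c', d'}" for a b c d a' b' c' d'
  proof (cases "a \<in> {a', b'}")
    case True
    then show ?thesis using inner_eq dia by blast
  next
    case False
    then have "0 < \<mu> a a'" "0 < \<mu> a b'" using a dia(2) by (auto simp: diamond_def mult_commute)
    then have "a' \<in> {b, c, d}" "b' \<in> {b, c, d}" using diamond_inner[OF dia(1)] by auto
    moreover have "\<not> (a' \<in> {c, d} \<and> b' \<in> {c, d})" using dia by (auto simp: diamond_def mult_commute)
    ultimately have "b \<in> {a', b'}" by auto
    then have "{b, a, c, d} = {a', b', c', d'}" using inner_eq diamond_commute dia by blast
    then show ?thesis by auto
  qed
  obtain a b c d where Xe: "X = {a, b, c, d}" and dX: "diamond a b c d" using X unfolding diamonds_iff by blast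
  obtain a' b' c' d' where Ye: "Y = {a', b', c', d'}" and dY: "diamond a' b' c' d'"
    using Y unfolding diamonds_iff by blast
  have "a \<in> Y \<or> b \<in> Y"
  proof (rule ccontr)
    assume n: "\<not> ?thesis"
    then obtain v where v: "v \<in> {c, d}" "v \<in> Y" using assms(3) Xe by auto
    have adj: "0 < \<mu> v a" "0 < \<mu> v b" using v dX by (auto simp: diamond_def mult_commute)
    have "v \<notin> {a', b'}"
      using diamond_inner[OF dY, of a] diamond_inner[OF diamond_commute(1)[OF dY], of a] adj n Ye by auto
    then have adj': "0 < \<mu> v a'" "0 < \<mu> v b'" using v Ye dY by (auto simp: diamond_def mult_commute)
    have "\<mu> v a + \<mu> v b + \<mu> v a' + \<mu> v b' \<le> 3"
      using n Ye dX dY by (intro mult_le3_4) (auto simp: diamond_def)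
    then show False using adj adj' by simp
  qed
  then show ?thesis
    using mid[OF dX dY] mid[OF diamond_commute(1)[OF dX] dY] Xe Ye by auto
qed

lemma digon_in_triangle:
  assumes "T \<in> triangles G" "v \<in> T" "2 \<le> \<mu> v u"
  shows "u \<in> T"
proof (rule ccontr)
  assume u: "u \<notin> T"
  obtain x y where xy: "x \<in> T" "y \<in> T" "distinct [v, x, y]"
    using assms(1,2) unfolding triangles_iff by auto
  have "0 < \<mu> v x" "0 < \<mu> v y"
    using xy assms by (auto simp: triangles_def mult_pos_iff[OF G])
  moreover have "\<mu> v x + \<mu> v y + \<mu> v u \<le> 3" using u xy by (intro mult_le3_3) auto
  ultimately show False using assms(3) by simp
qed

lemma triangle_mult_pos: "T \<in> triangles G \<Longrightarrow> u \<in> T \<Longrightarrow> v \<in> T \<Longrightarrow> u \<noteq> v \<Longrightarrow> 0 < \<mu> u v"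
  by (auto simp: triangles_def mult_pos_iff[OF G])

lemma triangle_at:
  assumes "T \<in> triangles G" "v \<in> T"
  obtains x y where "T = {v, x, y}" "distinct [v, x, y]"
  using assms unfolding triangles_iff by auto

text \<open>A common vertex has only three neighbours, so different triangles through it share a
  second vertex and form a diamond that meets \<open>T\<close>.\<close>

lemma triangles_disjoint:
  assumes T: "T \<in> free_triangles" and T': "T' \<in> triangles G" and "T \<inter> T' \<noteq> {}"
  shows "T = T'"
proof (rule ccontr)
  assume ne: "T \<noteq> T'"
  have Tt: "T \<in> triangles G" using T by (simp add: free_triangles_def)
  obtain v where v: "v \<in> T" "v \<in> T'" using assms(3) by blast
  obtain x y where xy: "T = {v, x, y}" "distinct [v, x, y]" using triangle_at[OF Tt v(1)] .
  obtain x' y' where xy': "T' = {v, x', y'}" "distinct [v, x', y']" using triangle_at[OF T' v(2)] .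
  have pos: "0 < \<mu> v x" "0 < \<mu> v y" "0 < \<mu> x y" using triangle_mult_pos[OF Tt] xy by auto
  have pos': "0 < \<mu> v x'" "0 < \<mu> v y'" "0 < \<mu> x' y'" using triangle_mult_pos[OF T'] xy' by auto
  have dia: False if "diamond v a b c" for a b c
    using that v T diamonds_iff[of "{v, a, b, c}"] unfolding free_triangles_def by blast
  have "\<not> distinct [x, y, x', y']"
    using mult_le3_4[of x y x' y' v] pos pos' by auto
  then consider "x = x'" | "x = y'" | "y = x'" | "y = y'" using xy xy' by auto
  then show False
  proof cases
    case 1
    then show ?thesis using dia[OF diamondI, of x y y'] pos pos' xy xy' ne by auto
  next
    case 2
    then show ?thesis using dia[OF diamondI, of x y x'] pos pos' xy xy' ne by (auto simp: mult_commute)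
  next
    case 3
    then show ?thesis using dia[OF diamondI, of y x y'] pos pos' xy xy' ne by (auto simp: mult_commute)
  next
    case 4
    then show ?thesis using dia[OF diamondI, of y x x'] pos pos' xy xy' ne by (auto simp: mult_commute)
  qed
qed

lemma digons_disjoint:
  assumes D: "D \<in> digons G" and D': "D' \<in> digons G" and "D \<inter> D' \<noteq> {}"
  shows "D = D'"
proof -
  obtain v where v: "v \<in> D" "v \<in> D'" using assms(3) by blast
  obtain u where u: "D = {v, u}" "2 \<le> \<mu> v u" using D v(1) unfolding digons_iff by (auto simp: mult_commute)
  obtain u' where u': "D' = {v, u'}" "2 \<le> \<mu> v u'" using D' v(2) unfolding digons_iff by (auto simp: mult_commute)
  have "u = u'" using mult_le3_2[of u u' v] u u' by fastforce
  then show ?thesis using u u' by simp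
qed

lemma digon_not_diamond:
  assumes D: "D \<in> digons G" and X: "X \<in> diamonds G"
  shows "D \<inter> X = {}"
proof (rule ccontr)
  assume "D \<inter> X \<noteq> {}"
  then obtain v where v: "v \<in> D" "v \<in> X" by blast
  obtain u where u: "D = {v, u}" "2 \<le> \<mu> v u" using D v(1) unfolding digons_iff by (auto simp: mult_commute)
  obtain a b c d where "X = {a, b, c, d}" "diamond a b c d" using X unfolding diamonds_iff by blast
  then show False using diamond_simple[of a b c d v u] v u by simp
qed

lemma free_digon_not_triangle:
  assumes D: "D \<in> free_digons" and T: "T \<in> triangles G"
  shows "D \<inter> T = {}"
proof (rule ccontr)
  assume "D \<inter> T \<noteq> {}"
  then obtain v where v: "v \<in> D" "v \<in> T" by blast
  have "D \<in> digons G" using D by (simp add: free_digons_def)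
  then obtain u where u: "D = {v, u}" "2 \<le> \<mu> v u" using v(1) unfolding digons_iff by (auto simp: mult_commute)
  then have "D \<subseteq> T" using digon_in_triangle[OF T v(2)] v by auto
  then show False using D T by (auto simp: free_digons_def)
qed

lemma disjoint_pieces: "disjoint pieces"
proof (rule disjointI, rule ccontr)
  fix X Y assume XY: "X \<in> pieces" "Y \<in> pieces" "X \<noteq> Y" "X \<inter> Y \<noteq> {}"
  have sub: "T \<in> triangles G" if "T \<in> free_triangles" for T
    using that by (simp add: free_triangles_def)
  have dt: "T \<inter> X = {}" if "T \<in> free_triangles" "X \<in> diamonds G" for T X
    using that by (simp add: free_triangles_def)
  have sub': "D \<in> digons G" if "D \<in> free_digons" for D using that by (simp add: free_digons_def)
  have YX: "Y \<inter> X \<noteq> {}" using XY(4) by blast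
  consider "X \<in> diamonds G" | "X \<in> free_triangles" | "X \<in> free_digons" using XY(1) unfolding pieces_def by blast
  then show False
  proof cases
    case 1
    then have "Y \<notin> diamonds G" "Y \<notin> free_triangles" "Y \<notin> free_digons"
      using XY(3,4) YX diamonds_disjoint[OF 1, of Y] dt[OF _ 1, of Y] digon_not_diamond[OF sub' 1, of Y]
      by metis+
    then show ?thesis using XY(2) unfolding pieces_def by blast
  next
    case 2
    have "Y \<notin> diamonds G" "Y \<notin> free_triangles" "Y \<notin> free_digons"
      using XY(3,4) YX triangles_disjoint[OF 2, of Y] dt[OF 2, of Y] sub[of Y]
        free_digon_not_triangle[OF _ sub[OF 2], of Y] by metis+
    then show ?thesis using XY(2) unfolding pieces_def by blast
  next
    case 3
    have "Y \<notin> diamonds G" "Y \<notin> free_triangles" "Y \<notin> free_digons"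
      using XY(3,4) digons_disjoint[OF sub'[OF 3], of Y] sub[of Y] sub'[of Y]
        digon_not_diamond[OF sub'[OF 3], of Y] free_digon_not_triangle[OF 3, of Y] by metis+
    then show ?thesis using XY(2) unfolding pieces_def by blast
  qed
qed

lemma pieces_cover:
  assumes v: "v \<in> verts G"
  shows "\<exists>X\<in>pieces. v \<in> X"
proof (cases "\<exists>T\<in>triangles G. v \<in> T")
  case True
  then obtain T where T: "T \<in> triangles G" "v \<in> T" by blast
  show ?thesis
  proof (cases "T \<in> free_triangles")
    case True
    then show ?thesis using T unfolding pieces_def by blast
  next
    case False
    then obtain X w where X: "X \<in> diamonds G" "w \<in> T" "w \<in> X" using T unfolding free_triangles_def by blast
    obtain a b c d where Xe: "X = {a, b, c, d}" and dia: "diamond a b c d" using X unfolding diamonds_iff by blast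
    \<comment> \<open>A triangle that meets a diamond lies inside it. Otherwise \<open>w\<close> is
      an end, adjacent to \<open>a\<close>, \<open>b\<close>, \<open>v\<close> and \<open>z\<close>:
      four neighbours are too many, and if \<open>z\<close> is itself inner, then an inner vertex
      has the neighbour \<open>v\<close> outside the diamond.\<close>
    have "v \<in> X"
    proof (rule ccontr)
      assume vX: "v \<notin> X"
      then have "v \<noteq> w" using X by blast
      then have vw: "0 < \<mu> w v" using triangle_mult_pos[OF T(1)] X T by auto
      then have "w \<notin> {a, b}" using vX Xe diamond_inner[OF dia] diamond_inner[OF diamond_commute(1)[OF dia]] by auto
      then have ab: "\<mu> w a = 1" "\<mu> w b = 1" using X Xe dia by (auto simp: diamond_def mult_commute)
      obtain z where z: "T = {v, w, z}" "distinct [v, w, z]"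
      proof -
        obtain x y where xy: "T = {w, x, y}" "distinct [w, x, y]" using triangle_at[OF T(1) X(2)] .
        then have "v = x \<or> v = y" using T(2) \<open>v \<noteq> w\<close> by simp
        then show ?thesis using that[of x] that[of y] xy by (auto simp: insert_commute)
      qed
      have "w \<in> T" "z \<in> T" "v \<in> T" "w \<noteq> z" "z \<noteq> v" using z by auto
      then have zp: "0 < \<mu> w z" "0 < \<mu> z v" by (simp_all add: triangle_mult_pos[OF T(1)])
      show False
      proof (cases "z \<in> {a, b}")
        case True
        then show ?thesis
          using zp vX Xe diamond_inner[OF dia] diamond_inner[OF diamond_commute(1)[OF dia]] by auto
      next
        case False
        then have "\<mu> w a + \<mu> w b + \<mu> w v + \<mu> w z \<le> 3"
          using vX Xe dia z by (intro mult_le3_4) (auto simp: diamond_def)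
        then show False using ab vw zp by simp
      qed
    qed
    then show ?thesis using X unfolding pieces_def by blast
  qed
next
  case False
  \<comment> \<open>If all edges at \<open>v\<close> were simple, two of its three neighbours would
    be adjacent by claw-freeness, and \<open>v\<close> would lie in a triangle.\<close>
  have "\<exists>u. 2 \<le> \<mu> v u"
  proof (rule ccontr)
    assume "\<not> ?thesis"
    then have le1: "\<mu> v u \<le> 1" for u by (metis Suc_1 not_less_eq_eq One_nat_def)
    let ?N = "{u \<in> verts G. 0 < \<mu> v u}"
    have "(\<Sum>u\<in>verts G. \<mu> v u) = (\<Sum>u\<in>?N. \<mu> v u)"
      by (rule sum.mono_neutral_right) (auto simp: finite_verts)
    also have "\<dots> = (\<Sum>u\<in>?N. 1)"
      using le1 by (intro sum.cong refl) (metis (mono_tags, lifting) One_nat_def Suc_leI le_antisym mem_Collect_eq)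
    finally have "card ?N = 3" using sum_mult[OF v] by simp
    then obtain x y z where N: "?N = {x, y, z}" "distinct [x, y, z]" by (auto simp: card_3_iff)
    then have pos: "0 < \<mu> v x" "0 < \<mu> v y" "0 < \<mu> v z" by blast+
    then have d: "distinct [v, x, y, z]" using N mult_pos_neq by auto
    have "0 < \<mu> x y \<or> 0 < \<mu> x z \<or> 0 < \<mu> y z" using claw_freeD[OF d pos] .
    then show False using False pos d triangles_iff
      by (metis (no_types, lifting) distinct_length_2_or_more distinct_singleton insertI1)
  qed
  then obtain u where u: "2 \<le> \<mu> v u" by blast
  then have "u \<noteq> v" by auto
  then have "{v, u} \<in> digons G" using u unfolding digons_iff by blast
  then have "{v, u} \<in> free_digons" using False unfolding free_digons_def by blast
  then show ?thesis unfolding pieces_def by blast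
qed

lemma pieces_verts: "X \<in> pieces \<Longrightarrow> X \<subseteq> verts G"
  unfolding pieces_def free_triangles_def free_digons_def diamonds_def triangles_def digons_def by blast

lemma card_diamond: "X \<in> diamonds G \<Longrightarrow> card X = 4"
  unfolding diamonds_iff diamond_def by auto

lemma partition_pieces: "partition_on (verts G) pieces"
proof (rule partition_onI)
  show "\<Union>pieces = verts G" using pieces_cover pieces_verts by blast
  show "disjnt p q" if "p \<in> pieces" "q \<in> pieces" "p \<noteq> q" for p q
    using that disjoint_pieces by (auto simp: disjoint_def disjnt_def)
  show "{} \<notin> pieces" unfolding pieces_def free_triangles_def free_digons_def triangles_def digons_def
    using card_diamond[of "{}"] by auto
qed

lemma finite_pieces: "finite pieces"
  using finite_elements[OF finite_verts partition_pieces] .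

lemma card_verts:
  "card (verts G) = 4 * card (diamonds G) + 3 * card free_triangles + 2 * card free_digons"
proof -
  have fin: "finite (diamonds G)" "finite free_triangles" "finite free_digons"
    using finite_pieces unfolding pieces_def by auto
  have c: "card X = 3" if "X \<in> free_triangles" for X using that by (auto simp: free_triangles_def triangles_def)
  have c': "card X = 2" if "X \<in> free_digons" for X using that by (auto simp: free_digons_def digons_def)
  have "card (verts G) = card (\<Union>pieces)" using partition_pieces by (auto simp: partition_on_def)
  also have "\<dots> = (\<Sum>X\<in>pieces. card X)"
  proof (rule card_Union_disjoint)
    show "pairwise disjnt pieces" using disjoint_pieces by (auto simp: disjoint_def pairwise_def disjnt_def)
    show "finite X" if "X \<in> pieces" for X using pieces_verts[OF that] finite_verts finite_subset by blast
  qed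
  also have "\<dots> = (\<Sum>X\<in>diamonds G. card X) + (\<Sum>X\<in>free_triangles. card X) + (\<Sum>X\<in>free_digons. card X)"
    unfolding pieces_def
    by (subst sum.union_disjoint; (subst sum.union_disjoint)?) (use fin c c' card_diamond in fastforce)+
  also have "\<dots> = 4 * card (diamonds G) + 3 * card free_triangles + 2 * card free_digons"
    using c c' card_diamond by simp
  finally show ?thesis .
qed

section \<open>Lower bound for the number of monochromatic edges\<close>

lemma triangle_monochromatic_edge:
  assumes T: "T \<in> triangles G" and B: "bisection G B W"
  shows "\<exists>e\<in>monochromatic_edges G B W. ends G e \<subseteq> T"
proof -
  obtain x y z where xyz: "T = {x, y, z}" "distinct [x, y, z]" using T unfolding triangles_iff by blast
  have "T \<subseteq> B \<union> W" using T B by (auto simp: triangles_def bisection_def)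
  then have "\<exists>u\<in>T. \<exists>v\<in>T. u \<noteq> v \<and> ({u, v} \<subseteq> B \<or> {u, v} \<subseteq> W)" using xyz by auto
  then obtain u v where uv: "u \<in> T" "v \<in> T" "u \<noteq> v" "{u, v} \<subseteq> B \<or> {u, v} \<subseteq> W" by blast
  obtain e where "e \<in> edges G" "ends G e = {u, v}"
    using mult_pos_edge[OF triangle_mult_pos[OF T uv(1-3)]] by blast
  then show ?thesis using uv unfolding monochromatic_edges_def by auto
qed

text \<open>A diamond contains a triangle and therefore also has a monochromatic edge; edges chosen
  in different pieces differ because the pieces are disjoint.\<close>

lemma num_mono_ge:
  assumes B: "bisection G B W"
  shows "card (diamonds G) + card free_triangles \<le> num_mono G B W"
proof -
  let ?P = "diamonds G \<union> free_triangles"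
  have "\<exists>e\<in>monochromatic_edges G B W. ends G e \<subseteq> X" if X: "X \<in> ?P" for X
  proof -
    have "\<exists>T\<in>triangles G. T \<subseteq> X"
    proof (cases "X \<in> diamonds G")
      case True
      then obtain a b c d where X': "X = {a, b, c, d}" "diamond a b c d" unfolding diamonds_iff by blast
      have "{a, b, c} \<in> triangles G" unfolding triangles_iff
        by (rule exI[of _ a], rule exI[of _ b], rule exI[of _ c]) (use X' in \<open>simp add: diamond_def\<close>)
      moreover have "{a, b, c} \<subseteq> X" using X' by blast
      ultimately show ?thesis by (rule bexI[rotated])
    next
      case False
      then show ?thesis using X by (auto simp: free_triangles_def)
    qed
    then show ?thesis using triangle_monochromatic_edge[OF _ B] by blast
  qed
  then obtain \<epsilon> where \<epsilon>: "\<And>X. X \<in> ?P \<Longrightarrow> \<epsilon> X \<in> monochromatic_edges G B W"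
    "\<And>X. X \<in> ?P \<Longrightarrow> ends G (\<epsilon> X) \<subseteq> X" by metis
  have "inj_on \<epsilon> ?P"
  proof (rule inj_onI)
    fix X Y assume XY: "X \<in> ?P" "Y \<in> ?P" "\<epsilon> X = \<epsilon> Y"
    have "ends G (\<epsilon> X) \<noteq> {}" using \<epsilon>(1)[OF XY(1)] G by (auto simp: monochromatic_edges_def multigraph_def)
    then have "X \<inter> Y \<noteq> {}" using \<epsilon>(2)[OF XY(1)] \<epsilon>(2)[OF XY(2)] XY(3) by auto
    then show "X = Y" using XY disjoint_pieces unfolding disjoint_def pieces_def by blast
  qed
  then have "card ?P \<le> num_mono G B W"
    unfolding num_mono_def using \<epsilon>(1) finite_edges
    by (intro card_inj_on_le[of \<epsilon>]) (auto simp: monochromatic_edges_def)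
  moreover have "card ?P = card (diamonds G) + card free_triangles"
  proof (rule card_Un_disjoint)
    show "diamonds G \<inter> free_triangles = {}"
      using card_diamond unfolding free_triangles_def triangles_def by fastforce
  qed (use finite_pieces in \<open>auto simp: pieces_def\<close>)
  ultimately show ?thesis by simp
qed

end

section \<open>The outer pairing of the ports\<close>

text \<open>If no vertex has two neighbours of its own colour, the monochromatic components are
  single vertices or pairs. Neighbours are counted rather than edges, so parallel edges do no
  harm.\<close>

lemma k_bisection_2I:
  assumes B: "bisection G B W"
    and unique: "\<And>v x y. v \<in> verts G \<Longrightarrow> adjacent G v x \<Longrightarrow> adjacent G v y
      \<Longrightarrow> (v \<in> B \<longleftrightarrow> x \<in> B) \<Longrightarrow> (v \<in> B \<longleftrightarrow> y \<in> B) \<Longrightarrow> x = y"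
  shows "k_bisection 2 G B W"
proof -
  have BW: "B \<union> W = verts G" "B \<inter> W = {}" using B by (auto simp: bisection_def)
  have sym: "adjacent G u v \<Longrightarrow> adjacent G v u" for u v by (auto simp: adjacent_def insert_commute)
  have "card (component_of (induced G S) u) \<le> 2"
    if S: "S = B \<or> S = W" and u: "u \<in> S" for S u
  proof -
    have SV: "S \<subseteq> verts G" using S BW by auto
    have side: "(x \<in> B \<longleftrightarrow> y \<in> B)" if "x \<in> S" "y \<in> S" for x y using that S BW by auto
    have inS: "x \<in> S \<and> y \<in> S \<and> adjacent G x y" if "adjacent (induced G S) x y" for x y
      using that unfolding adjacent_def induced_def by auto
    define N where "N = {x \<in> S. adjacent G u x}"
    have reach: "v = u \<or> v \<in> N" if "(adjacent (induced G S))\<^sup>*\<^sup>* u v" for v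
      using that
    proof (induction rule: rtranclp_induct)
      case (step y w)
      have yw: "y \<in> S" "w \<in> S" "adjacent G y w" using inS[OF step.hyps(2)] by auto
      show ?case
      proof (cases "y = u")
        case True
        then show ?thesis using yw by (auto simp: N_def)
      next
        case False
        then have "adjacent G y u" using step.IH sym by (auto simp: N_def)
        then have "w = u" using unique[of y w u] yw side u SV by blast
        then show ?thesis by simp
      qed
    qed simp
    have N1: "x = y" if "x \<in> N" "y \<in> N" for x y
    proof -
      have xy: "adjacent G u x" "adjacent G u y" "x \<in> S" "y \<in> S" using that by (auto simp: N_def)
      show ?thesis using unique[OF _ xy(1,2) side[OF u xy(3)] side[OF u xy(4)]] u SV by blast
    qed
    have "\<exists>w. component_of (induced G S) u \<subseteq> {u, w}"
    proof (cases "N = {}")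
      case True
      then show ?thesis using reach by (auto simp: component_of_def)
    next
      case False
      then obtain w where "w \<in> N" by blast
      then have "N = {w}" using N1 by blast
      then show ?thesis using reach by (auto simp: component_of_def)
    qed
    then obtain w where "component_of (induced G S) u \<subseteq> {u, w}" by blast
    then have "card (component_of (induced G S) u) \<le> card {u, w}" by (intro card_mono) auto
    also have "\<dots> \<le> 2" by (simp add: card_insert_if)
    finally show ?thesis .
  qed
  moreover have "verts (induced G S) \<subseteq> S" for S by (auto simp: induced_def)
  ultimately show ?thesis using B unfolding k_bisection_def components_def by blast
qed

context claw_free_cubic
begin

text \<open>\<open>diamond\<close> is symmetric in its first two arguments, so both inner vertices
  of each diamond are included.\<close>

definition inner :: "'v set" where
  "inner = {v. \<exists>b c d. diamond v b c d}"

definition ports :: "'v set" where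
  "ports = verts G - inner"

lemma diamond_pieces: "diamond a b c d \<Longrightarrow> {a, b, c, d} \<in> pieces"
  using diamonds_iff[of "{a, b, c, d}"] unfolding pieces_def by blast

lemma pieces_eq: "X \<in> pieces \<Longrightarrow> Y \<in> pieces \<Longrightarrow> v \<in> X \<Longrightarrow> v \<in> Y \<Longrightarrow> X = Y"
  using disjointD[OF disjoint_pieces] by blast

lemma inner_neighbour:
  assumes "v \<in> inner" "X \<in> pieces" "v \<in> X" "0 < \<mu> v u"
  shows "u \<in> X"
proof -
  obtain b c d where dia: "diamond v b c d" using assms(1) by (auto simp: inner_def)
  then have "X = {v, b, c, d}" using pieces_eq[OF assms(2) diamond_pieces[OF dia] assms(3)] by simp
  then show ?thesis using diamond_inner[OF dia assms(4)] by auto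
qed

text \<open>An inner vertex is adjacent to every other vertex of its diamond, whereas the two ends
  are not adjacent.\<close>

lemma diamond_end_not_inner:
  assumes dia: "diamond a b c d"
  shows "c \<notin> inner"
proof
  assume "c \<in> inner"
  then obtain a' b' d' where dia': "diamond c a' b' d'" by (auto simp: inner_def)
  have "{a, b, c, d} = {c, a', b', d'}"
    using pieces_eq[OF diamond_pieces[OF dia] diamond_pieces[OF dia'], of c] by simp
  then have "d \<in> {a', b', d'}" using dia by (auto simp: diamond_def)
  then have "0 < \<mu> c d" using dia' by (auto simp: diamond_def)
  then show False using dia by (simp add: diamond_def)
qed

lemma diamond_parts:
  assumes dia: "diamond a b c d"
  shows "a \<in> inner" "b \<in> inner" "c \<notin> inner" "d \<notin> inner" "{a, b, c, d} \<inter> ports = {c, d}"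
proof -
  show 1: "a \<in> inner" "b \<in> inner" "c \<notin> inner" "d \<notin> inner"
    using dia diamond_commute[OF dia] diamond_end_not_inner by (auto simp: inner_def)
  have "{a, b, c, d} \<subseteq> verts G" using pieces_verts[OF diamond_pieces[OF dia]] .
  then show "{a, b, c, d} \<inter> ports = {c, d}" using 1 by (auto simp: ports_def)
qed

lemma piece_ports:
  assumes "X \<in> free_triangles \<union> free_digons"
  shows "X \<subseteq> ports"
proof -
  have X: "X \<in> pieces" using assms by (auto simp: pieces_def)
  have "v \<notin> inner" if "v \<in> X" for v
  proof
    assume "v \<in> inner"
    then obtain b c d where dia: "diamond v b c d" by (auto simp: inner_def)
    have "X = {v, b, c, d}" using pieces_eq[OF X diamond_pieces[OF dia] that] by simp
    then have "card X = 4" using dia by (simp add: diamond_def)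
    moreover have "card X \<le> 3"
      using assms by (auto simp: free_triangles_def free_digons_def triangles_def digons_def)
    ultimately show False by simp
  qed
  then show ?thesis using pieces_verts[OF X] by (auto simp: ports_def)
qed

lemma piece_cases [consumes 3, case_names diamond triangle digon]:
  assumes "X \<in> pieces" "v \<in> X" "v \<in> ports"
  obtains a b d where "X = {a, b, v, d}" "diamond a b v d"
  | x y where "X = {v, x, y}" "distinct [v, x, y]" "X \<in> free_triangles"
  | x where "X = {v, x}" "2 \<le> \<mu> v x" "v \<noteq> x" "X \<in> free_digons"
proof -
  consider "X \<in> diamonds G" | "X \<in> free_triangles" | "X \<in> free_digons"
    using assms(1) unfolding pieces_def by blast
  then show thesis
  proof cases
    case 1
    then obtain a b c d where X: "X = {a, b, c, d}" "diamond a b c d" unfolding diamonds_iff by blast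
    then have "v = c \<or> v = d" using diamond_parts[OF X(2)] assms by auto
    then show thesis
      using that(1)[of a b d] that(1)[of a b c] X diamond_commute[OF X(2)] by (auto simp: insert_commute)
  next
    case 2
    then have "X \<in> triangles G" by (simp add: free_triangles_def)
    then obtain x y where "X = {v, x, y}" "distinct [v, x, y]" using triangle_at assms(2) by blast
    then show thesis using that(2) 2 by blast
  next
    case 3
    then have "X \<in> digons G" by (simp add: free_digons_def)
    then obtain x where "X = {v, x}" "2 \<le> \<mu> v x" "v \<noteq> x"
      using assms(2) unfolding digons_iff by (auto simp: mult_commute)
    then show thesis using that(3) 3 by blast
  qed
qed

section \<open>Edges leaving a piece and the pairing they induce\<close>

definition outer :: "'v \<Rightarrow> 'v \<Rightarrow> bool" where
  "outer v u \<longleftrightarrow> 0 < \<mu> v u \<and> (\<forall>X\<in>pieces. v \<in> X \<longrightarrow> u \<notin> X)"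

lemma outerI: "0 < \<mu> v u \<Longrightarrow> X \<in> pieces \<Longrightarrow> v \<in> X \<Longrightarrow> u \<notin> X \<Longrightarrow> outer v u"
  using pieces_eq unfolding outer_def by blast

lemma outer_sym: "outer v u \<Longrightarrow> outer u v"
  by (auto simp: outer_def mult_commute)

lemma outer_ports:
  assumes "outer v u"
  shows "v \<in> ports"
proof -
  have v: "v \<in> verts G" using assms mult_pos_verts(1)[of v u] by (simp add: outer_def)
  then obtain X where X: "X \<in> pieces" "v \<in> X" using pieces_cover by blast
  then have "v \<notin> inner" using inner_neighbour[of v X u] assms by (auto simp: outer_def)
  then show ?thesis using v by (simp add: ports_def)
qed

text \<open>With two of the three edges at a port kept inside its piece, at most one can leave it;
  this makes \<open>outer\<close> a partial function.\<close>

lemma sum_piece_ge: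
  assumes "X \<in> pieces" "v \<in> X" "v \<in> ports"
  shows "2 \<le> (\<Sum>u\<in>X. \<mu> v u)"
  using assms
proof (cases rule: piece_cases)
  case (diamond a b d)
  then show ?thesis by (simp add: diamond_def mult_commute)
next
  case (triangle x y)
  then have "X \<in> triangles G" by (simp add: free_triangles_def)
  then have "0 < \<mu> v x" "0 < \<mu> v y" using triangle_mult_pos[of X v] triangle by auto
  then show ?thesis using triangle by simp
next
  case (digon x)
  then show ?thesis by simp
qed

lemma outer_unique:
  assumes "outer v u" "outer v u'"
  shows "u = u'"
proof (rule ccontr)
  assume ne: "u \<noteq> u'"
  have v: "v \<in> verts G" using assms mult_pos_verts(1)[of v u] by (simp add: outer_def)
  then obtain X where X: "X \<in> pieces" "v \<in> X" using pieces_cover by blast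
  have u: "u \<notin> X" "u' \<notin> X" "0 < \<mu> v u" "0 < \<mu> v u'" using assms X by (auto simp: outer_def)
  have fin: "finite X" using X(1) pieces_verts finite_verts finite_subset by blast
  then have "(\<Sum>w\<in>insert u (insert u' X). \<mu> v w) \<le> 3" by (intro sum_mult_le) simp
  then show False using sum_piece_ge[OF X outer_ports[OF assms(1)]] u ne fin by simp
qed

text \<open>If \<open>v\<close> has no edge leaving its piece, then \<open>v\<close> lies on parallel edges, and one of those plays
  the role of the leaving edge; thus every triangle has three ports and every digon two.\<close>

definition partner :: "'v \<Rightarrow> 'v" where
  "partner v = (if \<exists>u. outer v u then SOME u. outer v u else SOME u. 2 \<le> \<mu> v u)"

lemma partner_outer: "outer v u \<Longrightarrow> partner v = u"
  unfolding partner_def using outer_unique by (auto intro: some_equality)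

lemma partner_parallel: "\<nexists>u. outer v u \<Longrightarrow> 2 \<le> \<mu> v u \<Longrightarrow> partner v = u"
  unfolding partner_def using mult_le3_2[of _ u v] by (fastforce intro: some_equality)

text \<open>A parallel pair together with the edge to the third vertex exhausts the degree at both
  ends. Neither end has a leaving edge, so \<open>partner\<close> falls back to the parallel edges
  at both of them and remains an involution.\<close>

lemma free_triangle_parallel:
  assumes T: "T \<in> free_triangles" and v: "v \<in> T" and u: "2 \<le> \<mu> v u"
  shows "u \<in> T" "\<nexists>w. outer v w" "\<nexists>w. outer u w"
proof -
  have Tt: "T \<in> triangles G" and Tp: "T \<in> pieces" using T by (auto simp: free_triangles_def pieces_def)
  show uT: "u \<in> T" using digon_in_triangle[OF Tt v u] .
  have no: False if *: "v \<in> T" "u \<in> T" "2 \<le> \<mu> v u" "outer v w" for u v w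
  proof -
    have w: "w \<notin> T" "0 < \<mu> v w" using that Tp by (auto simp: outer_def)
    have "v \<noteq> u" using that(3) by auto
    obtain x y where xy: "T = {v, x, y}" "distinct [v, x, y]" using triangle_at[OF Tt *(1)] .
    have "0 < \<mu> v x" "0 < \<mu> v y" using triangle_mult_pos[OF Tt] xy by auto
    moreover have "\<mu> v x + \<mu> v y + \<mu> v w \<le> 3" using xy w by (intro mult_le3_3) auto
    moreover have "u = x \<or> u = y" using that(2) xy \<open>v \<noteq> u\<close> by auto
    ultimately show False using that(3) w(2) by auto
  qed
  show "\<nexists>w. outer v w" using no[OF v uT u] by blast
  show "\<nexists>w. outer u w" using no[OF uT v] u by (auto simp: mult_commute)
qed

text \<open>All three edges at \<open>v\<close> stay in its piece. An end of a diamond has only two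
  edges there; in a triangle, three edges to two neighbours force a parallel pair; in a digon the
  edge is triple.\<close>

lemma parallel_of_no_outer:
  assumes v: "v \<in> ports" and no: "\<nexists>u. outer v u"
  shows "\<exists>u. 2 \<le> \<mu> v u \<and> (\<nexists>w. outer u w)"
proof -
  have vV: "v \<in> verts G" using v by (simp add: ports_def)
  then obtain X where X: "X \<in> pieces" "v \<in> X" using pieces_cover by blast
  have nb: "w \<in> X" if "0 < \<mu> v w" for w using outerI[OF that X] no by blast
  have "(\<Sum>u\<in>verts G. \<mu> v u) = (\<Sum>u\<in>X. \<mu> v u)"
    using nb pieces_verts[OF X(1)] finite_verts by (intro sum.mono_neutral_right) auto
  then have sum: "(\<Sum>u\<in>X. \<mu> v u) = 3" using sum_mult[OF vV] by simp
  from X v show ?thesis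
  proof (cases rule: piece_cases)
    case (diamond a b d)
    then show ?thesis using sum by (simp add: diamond_def mult_commute)
  next
    case (triangle x y)
    then have "\<mu> v x + \<mu> v y = 3" using sum by simp
    then have "2 \<le> \<mu> v x \<or> 2 \<le> \<mu> v y" by linarith
    then show ?thesis using free_triangle_parallel[OF triangle(3) X(2)] by blast
  next
    case (digon x)
    then have "\<mu> v x = 3" using sum by simp
    moreover have "\<not> outer x w" for w
    proof
      assume "outer x w"
      then have "w \<notin> X" "0 < \<mu> x w" using X(1) digon by (auto simp: outer_def)
      then have "\<mu> x v + \<mu> x w \<le> 3" using X(2) by (intro mult_le3_2) auto
      then show False using \<open>\<mu> v x = 3\<close> \<open>0 < \<mu> x w\<close> by (simp add: mult_commute)
    qed
    ultimately show ?thesis by (intro exI[of _ x]) simp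
  qed
qed

lemma partner_adjacent: "v \<in> ports \<Longrightarrow> 0 < \<mu> v (partner v) \<and> partner (partner v) = v \<and> partner v \<in> ports"
proof (cases "\<exists>u. outer v u")
  case True
  then obtain u where u: "outer v u" by blast
  then have "partner v = u" "partner u = v" "u \<in> ports"
    using partner_outer outer_sym outer_ports by blast+
  then show ?thesis using u by (simp add: outer_def)
next
  case False
  assume v: "v \<in> ports"
  obtain u where u: "2 \<le> \<mu> v u" "\<nexists>w. outer u w" using parallel_of_no_outer[OF v False] by blast
  then have "partner v = u" "partner u = v"
    using partner_parallel[OF False] partner_parallel[OF u(2)] by (auto simp: mult_commute)
  moreover have "u \<in> verts G" using u(1) mult_pos_verts(2)[of v u] by simp
  moreover have "u \<notin> inner"
  proof
    assume "u \<in> inner"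
    then obtain b c d where "diamond u b c d" by (auto simp: inner_def)
    then have "\<mu> u v \<le> 1" using diamond_simple[of u b c d u v] by simp
    then show False using u(1) by (simp add: mult_commute)
  qed
  ultimately show ?thesis using u(1) by (simp add: ports_def)
qed

lemma pairing_on_partner: "pairing_on ports partner"
  unfolding pairing_on_def
proof
  fix v assume "v \<in> ports"
  then show "partner v \<in> ports \<and> partner v \<noteq> v \<and> partner (partner v) = v"
    using partner_adjacent[of v] mult_pos_neq[of v "partner v"] by auto
qed

lemma card_piece_ports:
  assumes "X \<in> pieces"
  shows "card (X \<inter> ports) = 2 \<or> card (X \<inter> ports) = 3"
proof -
  consider "X \<in> diamonds G" | "X \<in> free_triangles" | "X \<in> free_digons"
    using assms unfolding pieces_def by blast
  then show ?thesis
  proof cases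
    case 1
    then obtain a b c d where X: "X = {a, b, c, d}" "diamond a b c d" unfolding diamonds_iff by blast
    then show ?thesis using diamond_parts(5)[OF X(2)] by (simp add: diamond_def)
  next
    case 2
    then have "X \<inter> ports = X" using piece_ports by blast
    then show ?thesis using 2 by (simp add: free_triangles_def triangles_def)
  next
    case 3
    then have "X \<inter> ports = X" using piece_ports by blast
    then show ?thesis using 3 by (simp add: free_digons_def digons_def)
  qed
qed

lemma port_system: "port_system ports partner ((\<lambda>X. X \<inter> ports) ` pieces)"
proof
  show "finite ports" using finite_verts by (simp add: ports_def)
  show "pairing_on ports partner" by (rule pairing_on_partner)
  show "card X = 2 \<or> card X = 3" if "X \<in> (\<lambda>X. X \<inter> ports) ` pieces" for X
    using that card_piece_ports by blast
  show "partition_on ports ((\<lambda>X. X \<inter> ports) ` pieces)"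
  proof (rule partition_onI)
    show "\<Union> ((\<lambda>X. X \<inter> ports) ` pieces) = ports"
      using pieces_cover by (auto simp: ports_def)
    show "disjnt p q" if "p \<in> (\<lambda>X. X \<inter> ports) ` pieces" "q \<in> (\<lambda>X. X \<inter> ports) ` pieces" "p \<noteq> q" for p q
      using that pieces_eq unfolding disjnt_def by blast
    show "{} \<notin> (\<lambda>X. X \<inter> ports) ` pieces"
      using card_piece_ports by force
  qed
next
  fix C assume C: "C \<subseteq> ports" "C \<noteq> {}" "partner ` C \<subseteq> C"
    and pc: "\<And>X. X \<in> (\<lambda>X. X \<inter> ports) ` pieces \<Longrightarrow> X \<subseteq> C \<or> X \<inter> C = {}"
  have pc': "v \<in> C" if "X \<in> pieces" "X \<inter> C \<noteq> {}" "v \<in> X" "v \<in> ports" for X v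
    using pc[of "X \<inter> ports"] that C(1) by blast
  \<comment> \<open>\<open>D\<close> is the union of the pieces meeting \<open>C\<close>. An edge
    stays in its piece or joins two partners, so \<open>D\<close> is closed under adjacency and, by
    connectedness, contains every vertex.\<close>
  define D where "D = {v. \<exists>X\<in>pieces. v \<in> X \<and> X \<inter> C \<noteq> {}}"
  have CD: "C \<subseteq> D" using pieces_cover C(1) unfolding D_def ports_def by blast
  have closed: "w \<in> D" if v: "v \<in> D" and vw: "0 < \<mu> v w" for v w
  proof -
    obtain X where X: "X \<in> pieces" "v \<in> X" "X \<inter> C \<noteq> {}" using v unfolding D_def by blast
    show ?thesis
    proof (cases "w \<in> X")
      case True
      then show ?thesis using X unfolding D_def by blast
    next
      case False
      then have o: "outer v w" using outerI[OF vw X(1,2)] by blast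
      then have "v \<in> C" using pc'[OF X(1,3,2)] outer_ports by blast
      then have "w \<in> C" using C(3) partner_outer[OF o] by blast
      then show ?thesis using CD by blast
    qed
  qed
  obtain u where u: "u \<in> C" using C(2) by blast
  have reach: "v \<in> D" if "(adjacent G)\<^sup>*\<^sup>* u v" for v
    using that
  proof (induction rule: rtranclp_induct)
    case base
    then show ?case using u CD by blast
  next
    case (step y z)
    then show ?case using closed mult_pos_iff[OF G] by blast
  qed
  have "v \<in> C" if v: "v \<in> ports" for v
  proof -
    have "(adjacent G)\<^sup>*\<^sup>* u v"
      using conn u v C(1) unfolding connected_multigraph_def ports_def by blast
    then obtain X where "X \<in> pieces" "v \<in> X" "X \<inter> C \<noteq> {}" using reach unfolding D_def by blast
    then show ?thesis using pc' v by blast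
  qed
  then show "C = ports" using C(1) by blast
qed

end

section \<open>Colouring\<close>

text \<open>The outcome of the transition argument, with \<open>q\<close> added: in every diamond it
  matches each inner vertex with one end, which yields both the colours of the inner vertices and
  the balance. \<open>X\<^sub>0\<close> is the one diamond whose ends may differ in colour.\<close>

locale coloured_ports = claw_free_cubic G for G :: "('v, 'e) multigraph" +
  fixes f :: "'v \<Rightarrow> bool" and n q :: "'v \<Rightarrow> 'v" and X\<^sub>0 :: "'v set"
  assumes n: "pairing_on ports n"
    and n_piece: "\<And>X. X \<in> pieces \<Longrightarrow> \<exists>x\<in>X. x \<in> ports \<and> n x \<in> X"
    and f_partner: "\<And>v. v \<in> ports \<Longrightarrow> f (partner v) = (\<not> f v)"
    and f_n: "\<And>v. v \<in> ports \<Longrightarrow> v \<notin> \<Union>(diamonds G) \<Longrightarrow> f (n v) = (\<not> f v)"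
    and f_diamond: "\<And>X u v. X \<in> diamonds G \<Longrightarrow> X \<noteq> X\<^sub>0 \<Longrightarrow> u \<in> X \<inter> ports \<Longrightarrow> v \<in> X \<inter> ports \<Longrightarrow> f u = f v"
    and q: "\<And>X. X \<in> diamonds G \<Longrightarrow>
      \<exists>a b c d. X = {a, b, c, d} \<and> diamond a b c d \<and> q a = c \<and> q c = a \<and> q b = d \<and> q d = b"
begin

text \<open>In a diamond \<open>{a, b, c, d}\<close> with ends \<open>c, d\<close> this makes \<open>ab\<close> the only monochromatic edge
  when \<open>c\<close> and \<open>d\<close> have equal colours, and \<open>ad\<close>, \<open>bc\<close> the only two otherwise.\<close>

definition colour :: "'v \<Rightarrow> bool" where
  "colour v = (if v \<in> inner then \<not> f (q v) else f v)"

lemma colour_ports: "v \<in> ports \<Longrightarrow> colour v = f v"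
  by (simp add: colour_def ports_def)

lemma diamond_colours:
  assumes "X \<in> diamonds G"
  obtains a b c d where "X = {a, b, c, d}" "diamond a b c d"
    "colour a = (\<not> colour c)" "colour b = (\<not> colour d)" "X \<noteq> X\<^sub>0 \<Longrightarrow> colour c = colour d"
    "q a = c" "q c = a" "q b = d" "q d = b"
proof -
  obtain a b c d where X: "X = {a, b, c, d}" "diamond a b c d" and q: "q a = c" "q c = a" "q b = d" "q d = b"
    using q[OF assms] by blast
  note parts = diamond_parts[OF X(2)]
  have "colour c = f c" "colour d = f d" "colour a = (\<not> f c)" "colour b = (\<not> f d)"
    using parts q by (simp_all add: colour_def)
  moreover have "f c = f d" if "X \<noteq> X\<^sub>0"
    using f_diamond[OF assms that, of c d] parts(5) X(1) by simp
  ultimately show ?thesis using that[of a b c d] X q by simp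
qed

lemma diamond_monochromatic_pair:
  assumes dia: "diamond a b c d" and col: "colour a = (\<not> colour c)" "colour b = (\<not> colour d)"
    and uv: "u \<in> {a, b, c, d}" "v \<in> {a, b, c, d}" "colour u = colour v" "0 < \<mu> u v"
  shows "if colour c = colour d then {u, v} = {a, b} else {u, v} = {b, c} \<or> {u, v} = {a, d}"
proof -
  have "\<mu> c d = 0" "\<mu> d c = 0" using dia by (auto simp: diamond_def mult_commute)
  then show ?thesis using uv(1,2) uv(3,4) col
    by (elim insertE emptyE) auto
qed

lemma piece_not_diamond:
  assumes "X \<in> free_triangles \<union> free_digons" "v \<in> X"
  shows "v \<notin> \<Union>(diamonds G)"
proof
  assume "v \<in> \<Union>(diamonds G)"
  then obtain Y where Y: "Y \<in> diamonds G" "v \<in> Y" by blast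
  then have "X = Y" using assms by (intro pieces_eq[of X Y v]) (auto simp: pieces_def)
  then have "card X = 4" using card_diamond Y by simp
  then show False using assms(1)
    by (auto simp: free_triangles_def free_digons_def triangles_def digons_def)
qed

text \<open>The two ports of a diamond are paired with each other, so neither of them is left for a
  port elsewhere.\<close>

lemma n_not_diamond:
  assumes v: "v \<in> ports" "v \<notin> \<Union>(diamonds G)"
  shows "n v \<notin> \<Union>(diamonds G)"
proof
  assume "n v \<in> \<Union>(diamonds G)"
  then obtain X where X: "X \<in> diamonds G" "n v \<in> X" by blast
  obtain a b c d where Xe: "X = {a, b, c, d}" "diamond a b c d" using X(1) unfolding diamonds_iff by blast
  have nv: "n v \<in> ports" "n (n v) = v" using n v(1) by (auto simp: pairing_on_def)
  have P: "X \<inter> ports = {c, d}" using diamond_parts(5)[OF Xe(2)] Xe(1) by simp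
  have "X \<in> pieces" using X by (simp add: pieces_def)
  then obtain x where x: "x \<in> X" "x \<in> ports" "n x \<in> X" using n_piece by blast
  have nx: "n x \<noteq> x" "n (n x) = x" "n x \<in> ports" using n x(2) by (auto simp: pairing_on_def)
  have "x \<in> {c, d}" "n x \<in> {c, d}" using P x nx by blast+
  then have "{c, d} = {x, n x}" using nx by auto
  then have "n v = x \<or> n v = n x" using P X(2) nv by blast
  then have "v = n x \<or> v = x" using nx nv by metis
  then show False using v(2) X(1) x by blast
qed

text \<open>Equal halves come from a colour-reversing involution of all vertices: \<open>n\<close>
  outside the diamonds and \<open>q\<close> inside them, where \<open>n\<close> may preserve
  colours.\<close>

lemma colour_balanced:
  "card {v \<in> verts G. colour v} = card {v \<in> verts G. \<not> colour v}"
proof (rule card_balanced_pairing_on)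
  let ?N = "\<lambda>v. if v \<in> \<Union>(diamonds G) then q v else n v"
  have dia: "q v \<in> X \<and> q v \<noteq> v \<and> q (q v) = v \<and> colour (q v) = (\<not> colour v)"
    if X: "X \<in> diamonds G" "v \<in> X" for X v
  proof -
    obtain a b c d where "X = {a, b, c, d}" "diamond a b c d"
      "colour a = (\<not> colour c)" "colour b = (\<not> colour d)" "q a = c" "q c = a" "q b = d" "q d = b"
      using diamond_colours[OF X(1)] by metis
    then show ?thesis using X(2) by (auto simp: diamond_def)
  qed
  have port: "v \<in> ports" if v: "v \<in> verts G" "v \<notin> \<Union>(diamonds G)" for v
  proof -
    have "v \<notin> inner"
    proof
      assume "v \<in> inner"
      then obtain b c d where "diamond v b c d" by (auto simp: inner_def)
      then have "{v, b, c, d} \<in> diamonds G" using diamonds_iff[of "{v, b, c, d}"] by blast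
      then show False using v(2) by blast
    qed
    then show ?thesis using v by (simp add: ports_def)
  qed
  show "pairing_on (verts G) ?N"
    unfolding pairing_on_def
  proof
    fix v assume v: "v \<in> verts G"
    show "?N v \<in> verts G \<and> ?N v \<noteq> v \<and> ?N (?N v) = v"
    proof (cases "v \<in> \<Union>(diamonds G)")
      case True
      then obtain X where X: "X \<in> diamonds G" "v \<in> X" by blast
      then have "X \<subseteq> verts G" by (auto simp: diamonds_def)
      then show ?thesis using dia[OF X] X by auto
    next
      case False
      then have "v \<in> ports" using port v by blast
      then have "n v \<in> ports" "n v \<noteq> v" "n (n v) = v" using n by (auto simp: pairing_on_def)
      then show ?thesis using False n_not_diamond[OF \<open>v \<in> ports\<close> False] by (simp add: ports_def)
    qed
  qed
  show "colour (?N v) = (\<not> colour v)" if v: "v \<in> verts G" for v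
  proof (cases "v \<in> \<Union>(diamonds G)")
    case True
    then show ?thesis using dia by auto
  next
    case False
    then have "v \<in> ports" using port v by blast
    moreover have "n v \<in> ports" using n \<open>v \<in> ports\<close> by (auto simp: pairing_on_def)
    ultimately show ?thesis using False f_n[OF \<open>v \<in> ports\<close> False] colour_ports by simp
  qed
qed

lemma outer_colour: "outer v u \<Longrightarrow> colour u = (\<not> colour v)"
  using f_partner[of v] partner_outer[of v u] outer_ports[of v u] outer_ports[OF outer_sym, of v u] colour_ports
  by simp

lemma same_colour_piece:
  assumes "0 < \<mu> v u" "colour u = colour v" "X \<in> pieces" "v \<in> X"
  shows "u \<in> X"
  using outerI[OF assms(1,3,4)] outer_colour assms(2) by blast

lemma digon_colours:
  assumes "X \<in> free_digons" "u \<in> X" "v \<in> X" "u \<noteq> v"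
  shows "colour u = (\<not> colour v)"
proof -
  have X: "X \<in> pieces" "X \<subseteq> ports" using assms(1) piece_ports by (auto simp: pieces_def)
  then obtain x where x: "x \<in> X" "n x \<in> X" using n_piece by blast
  then have "n x \<noteq> x" using n X(2) by (auto simp: pairing_on_def)
  have "card X = 2" using assms(1) by (simp add: free_digons_def digons_def)
  then obtain y z where "X = {y, z}" by (auto simp: card_2_iff)
  then have "(u = x \<and> v = n x) \<or> (u = n x \<and> v = x)" using assms x \<open>n x \<noteq> x\<close> by auto
  moreover have "f (n x) = (\<not> f x)"
    using f_n[of x] x X(2) piece_not_diamond[of X x] assms(1) by blast
  moreover have "colour x = f x" "colour (n x) = f (n x)" using x X(2) colour_ports by auto
  ultimately show ?thesis by auto
qed

text \<open>The internal pair of the transition is bichromatic, so the third vertex agrees with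
  exactly one of its ports. Parallel vertices of a triangle are partners and hence differ in colour;
  therefore the monochromatic pair accounts for a single edge.\<close>

lemma triangle_colours:
  assumes "X \<in> free_triangles"
  obtains x y z where "X = {x, y, z}" "distinct [x, y, z]" "colour x = colour y" "colour z = (\<not> colour x)"
    "\<mu> x y = 1"
proof -
  have X: "X \<in> pieces" "X \<subseteq> ports" "X \<in> triangles G"
    using assms piece_ports by (auto simp: pieces_def free_triangles_def)
  then obtain a where a: "a \<in> X" "n a \<in> X" using n_piece by blast
  then have "n a \<noteq> a" using n X(2) by (auto simp: pairing_on_def)
  obtain x y where xy: "X = {a, x, y}" "distinct [a, x, y]" using triangle_at[OF X(3) a(1)] .
  have "f (n a) = (\<not> f a)"
    using f_n[of a] a X(2) piece_not_diamond[of X a] assms by blast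
  then have na: "colour (n a) = (\<not> colour a)" using a X(2) colour_ports by auto
  obtain c where c: "X = {a, n a, c}" "distinct [a, n a, c]"
  proof -
    have "n a = x \<or> n a = y" using xy a(2) \<open>n a \<noteq> a\<close> by blast
    then show ?thesis using that[of x] that[of y] xy by (auto simp: insert_commute)
  qed
  have one: "\<mu> u v = 1" if uv: "u \<in> X" "v \<in> X" "u \<noteq> v" "colour u = colour v" for u v
  proof (rule ccontr)
    assume "\<mu> u v \<noteq> 1"
    then have 2: "2 \<le> \<mu> u v" using triangle_mult_pos[OF X(3) uv(1-3)] by linarith
    have "partner u = v" using partner_parallel[OF free_triangle_parallel(2)[OF assms uv(1) 2] 2] .
    then have "f v = (\<not> f u)" using f_partner[of u] uv X(2) by blast
    then show False using uv X(2) colour_ports by auto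
  qed
  show thesis
  proof (cases "colour c = colour a")
    case True
    then have "\<mu> a c = 1" using c by (intro one) auto
    moreover have "X = {a, c, n a}" using c by auto
    ultimately show thesis using that[of a c "n a"] c(2) na True by auto
  next
    case False
    then have eq: "colour (n a) = colour c" using na by simp
    then have "\<mu> (n a) c = 1" using c by (intro one) auto
    moreover have "X = {n a, c, a}" using c by auto
    moreover have "distinct [n a, c, a]" "colour a = (\<not> colour (n a))" using c(2) na by auto
    ultimately show thesis using that eq by metis
  qed
qed

text \<open>Edges leaving a piece are bichromatic, so only neighbours inside the piece matter, and
  there the adjacent pairs of equal colour are disjoint.\<close>

lemma same_colour_neighbour:
  assumes v: "v \<in> verts G" and x: "0 < \<mu> v x" "colour x = colour v"
    and y: "0 < \<mu> v y" "colour y = colour v"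
  shows "x = y"
proof -
  obtain X where X: "X \<in> pieces" "v \<in> X" using pieces_cover[OF v] by blast
  have xy: "x \<in> X" "y \<in> X" "x \<noteq> v" "y \<noteq> v"
    using same_colour_piece[OF x X] same_colour_piece[OF y X] mult_pos_neq x(1) y(1) by blast+
  consider "X \<in> diamonds G" | "X \<in> free_triangles" | "X \<in> free_digons"
    using X(1) unfolding pieces_def by blast
  then show ?thesis
  proof cases
    case 1
    obtain a b c d where Xe: "X = {a, b, c, d}" "diamond a b c d"
      "colour a = (\<not> colour c)" "colour b = (\<not> colour d)"
      using diamond_colours[OF 1] by metis
    note pair = diamond_monochromatic_pair[OF Xe(2-4), of v]
    have "distinct [a, b, c, d]" using Xe(2) by (simp add: diamond_def)
    then show ?thesis
      using pair[of x] pair[of y] X(2) xy x y Xe(1) by (auto simp: doubleton_eq_iff split: if_splits)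
  next
    case 2
    obtain a b c where "X = {a, b, c}" "colour a = colour b" "colour c = (\<not> colour a)"
      using triangle_colours[OF 2] by metis
    then show ?thesis using X(2) xy x(2) y(2) by auto
  next
    case 3
    then show ?thesis using digon_colours[OF 3 X(2) xy(1)] xy x(2) by auto
  qed
qed

section \<open>The 2-bisection and its monochromatic edges\<close>

abbreviation Black :: "'v set" where "Black \<equiv> {v \<in> verts G. colour v}"
abbreviation White :: "'v set" where "White \<equiv> {v \<in> verts G. \<not> colour v}"

lemma bisection_colour: "bisection G Black White"
  using colour_balanced by (auto simp: bisection_def)

lemma k_bisection_colour: "k_bisection 2 G Black White"
proof (rule k_bisection_2I[OF bisection_colour])
  fix v x y
  assume v: "v \<in> verts G" and adj: "adjacent G v x" "adjacent G v y"
    and side: "v \<in> Black \<longleftrightarrow> x \<in> Black" "v \<in> Black \<longleftrightarrow> y \<in> Black"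
  have pos: "0 < \<mu> v x" "0 < \<mu> v y" using adj mult_pos_iff[OF G] by auto
  then have "x \<in> verts G" "y \<in> verts G" using mult_pos_verts by blast+
  then have "colour x = colour v" "colour y = colour v" using side v by auto
  then show "x = y" using same_colour_neighbour[OF v pos(1) _ pos(2)] by blast
qed

lemma monochromatic_edge_cases:
  assumes e: "e \<in> monochromatic_edges G Black White"
  obtains u v where "ends G e = {u, v}" "u \<noteq> v" "colour u = colour v" "0 < \<mu> u v" "e \<in> edges G"
proof -
  have eE: "e \<in> edges G" and side: "ends G e \<subseteq> Black \<or> ends G e \<subseteq> White"
    using e by (auto simp: monochromatic_edges_def)
  then have "card (ends G e) = 2" using G by (simp add: multigraph_def)
  then obtain u v where uv: "ends G e = {u, v}" "u \<noteq> v" unfolding card_2_iff by blast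
  moreover have "colour u = colour v" using side uv(1) by auto
  moreover have "0 < \<mu> u v" using eE uv mult_pos_iff[OF G] by (auto simp: adjacent_def)
  ultimately show thesis using that eE by blast
qed

text \<open>Edges between pieces and edges of free digons contribute nothing, each triangle or
  diamond at most one edge, and only \<open>X\<^sub>0\<close> possibly two. The extra 1 is allowed
  for either parity of \<open>k\<close>; evenness decides later whether it is attained.\<close>

lemma num_mono_le:
  "num_mono G Black White \<le> card (diamonds G) + card free_triangles + 1"
proof -
  let ?M = "monochromatic_edges G Black White"
  define M where "M X = {e \<in> ?M. ends G e \<subseteq> X}" for X
  let ?P = "diamonds G \<union> free_triangles"
  have finM: "finite ?M" using finite_edges by (simp add: monochromatic_edges_def)
  have finP: "finite ?P" using finite_pieces by (simp add: pieces_def)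
  have le_mult: "card {e \<in> edges G. ends G e = {u, v}} = \<mu> u v" for u v by (simp add: mult_def)
  have "?M \<subseteq> (\<Union>X\<in>?P. M X)"
  proof
    fix e assume e: "e \<in> ?M"
    then obtain u v where uv: "ends G e = {u, v}" "u \<noteq> v" "colour u = colour v" "0 < \<mu> u v"
      using monochromatic_edge_cases[OF e] by metis
    then have "u \<in> verts G" using mult_pos_verts by blast
    then obtain X where X: "X \<in> pieces" "u \<in> X" using pieces_cover by blast
    then have "v \<in> X" using same_colour_piece[OF uv(4) uv(3)[symmetric]] by blast
    then have "X \<notin> free_digons" using digon_colours[of X u v] X uv by blast
    then have "X \<in> ?P" using X(1) by (auto simp: pieces_def)
    then show "e \<in> (\<Union>X\<in>?P. M X)" using e uv X \<open>v \<in> X\<close> by (auto simp: M_def)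
  qed
  then have "card ?M \<le> card (\<Union>X\<in>?P. M X)"
    using finM finP by (intro card_mono) (auto simp: M_def)
  also have "\<dots> \<le> (\<Sum>X\<in>?P. card (M X))" by (rule card_UN_le[OF finP])
  also have "\<dots> \<le> (\<Sum>X\<in>?P. 1 + of_bool (X = X\<^sub>0))"
  proof (rule sum_mono)
    fix X assume X: "X \<in> ?P"
    show "card (M X) \<le> 1 + of_bool (X = X\<^sub>0)"
    proof (cases "X \<in> diamonds G")
      case True
      then obtain a b c d where Xe: "X = {a, b, c, d}" "diamond a b c d"
        "colour a = (\<not> colour c)" "colour b = (\<not> colour d)" "X \<noteq> X\<^sub>0 \<Longrightarrow> colour c = colour d"
        using diamond_colours[OF True] by metis
      have mult: "\<mu> a b = 1" "\<mu> b c = 1" "\<mu> a d = 1" "\<mu> c d = 0" "\<mu> d c = 0"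
        using Xe(2) by (auto simp: diamond_def mult_commute)
      show ?thesis
      proof (cases "colour c = colour d")
        case True
        have "M X \<subseteq> {e \<in> edges G. ends G e = {a, b}}"
        proof
          fix e assume e: "e \<in> M X"
          then obtain u v where uv: "ends G e = {u, v}" "u \<noteq> v" "colour u = colour v" "0 < \<mu> u v" "e \<in> edges G"
            using monochromatic_edge_cases[of e] e unfolding M_def mem_Collect_eq by metis
          have uvX: "u \<in> X" "v \<in> X" using e uv(1) by (auto simp: M_def)
          then have "{u, v} = {a, b}"
            using diamond_monochromatic_pair[OF Xe(2-4), of u v] uv True Xe(1) by simp
          then show "e \<in> {e \<in> edges G. ends G e = {a, b}}" using uv by simp
        qed
        then have "card (M X) \<le> \<mu> a b" unfolding le_mult[symmetric]
          using finite_edges by (intro card_mono) auto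
        then show ?thesis using mult by simp
      next
        case False
        have "M X \<subseteq> {e \<in> edges G. ends G e = {b, c}} \<union> {e \<in> edges G. ends G e = {a, d}}"
        proof
          fix e assume e: "e \<in> M X"
          then obtain u v where uv: "ends G e = {u, v}" "u \<noteq> v" "colour u = colour v" "0 < \<mu> u v" "e \<in> edges G"
            using monochromatic_edge_cases[of e] e unfolding M_def mem_Collect_eq by metis
          have uvX: "u \<in> X" "v \<in> X" using e uv(1) by (auto simp: M_def)
          then have "{u, v} = {b, c} \<or> {u, v} = {a, d}"
            using diamond_monochromatic_pair[OF Xe(2-4), of u v] uv False Xe(1) by simp
          then show "e \<in> {e \<in> edges G. ends G e = {b, c}} \<union> {e \<in> edges G. ends G e = {a, d}}" using uv by simp
        qed
        then have "card (M X) \<le> card ({e \<in> edges G. ends G e = {b, c}} \<union> {e \<in> edges G. ends G e = {a, d}})"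
          using finite_edges by (intro card_mono) auto
        also have "\<dots> \<le> \<mu> b c + \<mu> a d" unfolding le_mult[symmetric] by (rule card_Un_le)
        finally show ?thesis using mult False Xe(5) by auto
      qed
    next
      case False
      then have T: "X \<in> free_triangles" using X by simp
      obtain x y z where xyz: "X = {x, y, z}" "colour x = colour y" "colour z = (\<not> colour x)" "\<mu> x y = 1"
        using triangle_colours[OF T] by metis
      have "M X \<subseteq> {e \<in> edges G. ends G e = {x, y}}"
      proof
        fix e assume e: "e \<in> M X"
        then obtain u v where uv: "ends G e = {u, v}" "u \<noteq> v" "colour u = colour v" "0 < \<mu> u v" "e \<in> edges G"
          using monochromatic_edge_cases[of e] e unfolding M_def mem_Collect_eq by metis
        have "u \<in> X" "v \<in> X" using e uv(1) by (auto simp: M_def)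
        then have "{u, v} = {x, y}" using xyz(1-3) uv(2,3) by (auto simp: insert_commute)
        then show "e \<in> {e \<in> edges G. ends G e = {x, y}}" using uv by simp
      qed
      then have "card (M X) \<le> \<mu> x y" unfolding le_mult[symmetric]
        using finite_edges by (intro card_mono) auto
      then show ?thesis using xyz by simp
    qed
  qed
  also have "\<dots> = card ?P + (\<Sum>X\<in>?P. of_bool (X = X\<^sub>0))"
    by (subst sum.distrib) simp
  also have "(\<Sum>X\<in>?P. of_bool (X = X\<^sub>0)) \<le> (1::nat)"
    using finP by (simp add: of_bool_def)
  also have "card ?P \<le> card (diamonds G) + card free_triangles" by (rule card_Un_le)
  finally show ?thesis by (simp add: num_mono_def)
qed

end

section \<open>Existence of the colouring and the exact value\<close>

context claw_free_cubic
begin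

lemma coloured_ports_exists: "\<exists>f n q X\<^sub>0. coloured_ports G f n q X\<^sub>0"
proof -
  let ?p = "\<lambda>X. X \<inter> ports"
  interpret port_system ports partner "?p ` pieces" by (rule port_system)
  have sub: "?p ` diamonds G \<subseteq> ?p ` pieces" by (auto simp: pieces_def)
  have card2: "card X = 2" if X: "X \<in> ?p ` diamonds G" for X
  proof -
    obtain Y where "Y \<in> diamonds G" "X = Y \<inter> ports" using X by blast
    moreover then obtain a b c d where "Y = {a, b, c, d}" "diamond a b c d" unfolding diamonds_iff by blast
    ultimately show ?thesis using diamond_parts(5)[of a b c d] by (simp add: diamond_def)
  qed
  obtain f n X0 where tr: "transition n" and f: "proper f"
    and fn: "\<And>v. v \<in> ports - \<Union>(?p ` diamonds G) \<Longrightarrow> f (n v) = (\<not> f v)"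
    and fX: "\<And>X u v. X \<in> ?p ` diamonds G - {X0} \<Longrightarrow> u \<in> X \<Longrightarrow> v \<in> X \<Longrightarrow> f u = f v"
    using port_colouring[OF sub card2] by metis
  \<comment> \<open>\<open>X0\<close> is a set of ports, whereas the exceptional piece is to be a
    diamond. \<open>X1\<close> is the diamond with exactly these ports, unique by disjointness, and
    arbitrary if there is none.\<close>
  have "\<exists>X1. \<forall>X\<in>diamonds G. ?p X = X0 \<longrightarrow> X = X1"
  proof (cases "\<exists>X\<in>diamonds G. ?p X = X0")
    case True
    then obtain X1 where X1: "X1 \<in> diamonds G" "?p X1 = X0" by blast
    have "X = X1" if X: "X \<in> diamonds G" "?p X = X0" for X
    proof -
      have "card X0 = 2" using card2 X1 by blast
      then obtain v where "v \<in> X0" by (metis card.empty equals0I zero_neq_numeral)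
      then have "v \<in> X" "v \<in> X1" using X X1 by blast+
      then show ?thesis using diamonds_disjoint[OF X(1) X1(1)] by blast
    qed
    then show ?thesis by blast
  qed blast
  then obtain X1 where X1: "\<And>X. X \<in> diamonds G \<Longrightarrow> ?p X = X0 \<Longrightarrow> X = X1" by blast
  have disj: "disjoint (diamonds G)" using diamonds_disjoint by (auto simp: disjoint_def)
  have "\<exists>q. \<forall>X\<in>diamonds G. \<exists>a b c d. X = {a, b, c, d} \<and> diamond a b c d \<and> q a = c \<and> q c = a \<and> q b = d \<and> q d = b"
  proof (rule glue_disjoint[OF disj])
    fix X assume "X \<in> diamonds G"
    then obtain a b c d where X: "X = {a, b, c, d}" "diamond a b c d" unfolding diamonds_iff by blast
    define q where "q = id(a := c, c := a, b := d, d := b)"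
    have "q a = c \<and> q c = a \<and> q b = d \<and> q d = b" using X(2) by (auto simp: q_def diamond_def)
    then show "\<exists>q. \<exists>a b c d. X = {a, b, c, d} \<and> diamond a b c d \<and> q a = c \<and> q c = a \<and> q b = d \<and> q d = b"
      using X by blast
  next
    fix X :: "'v set" and h h' :: "'v \<Rightarrow> 'v"
    assume eq: "\<And>v. v \<in> X \<Longrightarrow> h' v = h v"
      and "\<exists>a b c d. X = {a, b, c, d} \<and> diamond a b c d \<and> h a = c \<and> h c = a \<and> h b = d \<and> h d = b"
    then obtain a b c d where X: "X = {a, b, c, d}" "diamond a b c d" "h a = c \<and> h c = a \<and> h b = d \<and> h d = b"
      by blast
    then have "h' a = c \<and> h' c = a \<and> h' b = d \<and> h' d = b" using eq by simp
    then show "\<exists>a b c d. X = {a, b, c, d} \<and> diamond a b c d \<and> h' a = c \<and> h' c = a \<and> h' b = d \<and> h' d = b"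
      using X(1,2) by blast
  qed
  then obtain q where q: "\<forall>X\<in>diamonds G.
    \<exists>a b c d. X = {a, b, c, d} \<and> diamond a b c d \<and> q a = c \<and> q c = a \<and> q b = d \<and> q d = b" ..
  have "coloured_ports G f n q X1"
  proof
    show "pairing_on ports n" using tr by (simp add: transition_def)
    show "\<exists>x\<in>X. x \<in> ports \<and> n x \<in> X" if "X \<in> pieces" for X
    proof -
      have "X \<inter> ports \<in> ?p ` pieces" using that by blast
      then obtain x where "x \<in> X \<inter> ports" "n x \<in> X \<inter> ports"
        using tr unfolding transition_def by metis
      then show ?thesis by blast
    qed
    show "f (partner v) = (\<not> f v)" if "v \<in> ports" for v using f that by (simp add: proper_def)
    show "f (n v) = (\<not> f v)" if "v \<in> ports" "v \<notin> \<Union>(diamonds G)" for v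
      using that by (intro fn) auto
    show "f u = f v" if "X \<in> diamonds G" "X \<noteq> X1" "u \<in> X \<inter> ports" "v \<in> X \<inter> ports" for X u v
      using that X1 by (intro fX[of "?p X"]) auto
  qed (rule bspec[OF q])
  then show ?thesis by blast
qed

end

theorem theorem3:
  fixes G :: "('v, 'e) multigraph" and k p :: nat
  assumes "multigraph G"
    and "connected_multigraph G"
    and "claw_free G"
    and "cubic G"
    and "\<not> isomorphic G K4"
    and "k = card (diamonds G)"
    and "p = card {D \<in> digons G. \<not> (\<exists>T\<in>triangles G. D \<subseteq> T)}"
  shows "\<exists>B W. k_bisection 2 G B W \<and>
    real (num_mono G B W) =
      (if even k then (real (card (verts G)) - real k - 2 * real p) / 3
       else (real (card (verts G)) - real k - 2 * real p) / 3 + 1) \<and>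
    (\<forall>B' W'. k_bisection 2 G B' W' \<longrightarrow> num_mono G B W \<le> num_mono G B' W')"
proof -
  interpret claw_free_cubic G using assms(1-5) by unfold_locales
  obtain f n q X where "coloured_ports G f n q X" using coloured_ports_exists by blast
  then interpret coloured_ports G f n q X .
  define t where "t = card free_triangles"
  have p: "p = card free_digons" using assms(7) by (simp add: free_digons_def)
  have n: "card (verts G) = 4 * k + 3 * t + 2 * p" using card_verts by (simp add: t_def assms(6) p)
  have "card (verts G) = card (Black \<union> White)" by (rule arg_cong[where f = card]) auto
  also have "\<dots> = 2 * card Black"
    by (subst card_Un_disjoint) (use finite_verts colour_balanced in auto)
  finally have "even (4 * k + 3 * t + 2 * p)" using n by simp
  then have t: "even t" by simp
  \<comment> \<open>\<open>num_mono\<close> is even and \<open>k + t\<close> has the parity of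
    \<open>k\<close>, so for odd \<open>k\<close> the value \<open>k + t\<close> is out of
    reach.\<close>
  have lower: "k + t + (if even k then 0 else 1) \<le> num_mono G B W" if "bisection G B W" for B W
  proof -
    have "even (num_mono G B W)" by (rule even_num_mono[OF assms(1,4) that])
    moreover have "k + t \<le> num_mono G B W" using num_mono_ge[OF that] by (simp add: t_def assms(6))
    ultimately show ?thesis using t by (cases "num_mono G B W = k + t") auto
  qed
  \<comment> \<open>For even \<open>k\<close> the upper bound \<open>k + t + 1\<close> is odd and
    drops to \<open>k + t\<close>; for odd \<open>k\<close> it already meets the lower
    bound.\<close>
  have "num_mono G Black White = k + t + (if even k then 0 else 1)"
  proof -
    have "even (num_mono G Black White)" by (rule even_num_mono[OF assms(1,4) bisection_colour])
    moreover have "num_mono G Black White \<le> k + t + 1" using num_mono_le by (simp add: t_def assms(6))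
    ultimately show ?thesis using lower[OF bisection_colour] t
      by (cases "num_mono G Black White = k + t + 1") auto
  qed
  moreover have "num_mono G Black White \<le> num_mono G B' W'" if "k_bisection 2 G B' W'" for B' W'
    using lower[of B' W'] that calculation by (simp add: k_bisection_def)
  ultimately show ?thesis
    using k_bisection_colour n by (intro exI[of _ Black] exI[of _ White]) auto
qed

end
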